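(* Let $\Phi$ denote the standard normal CDF and let $\eta_0 := 2\left(1-\Phi(\sqrt{2\log 2})\right)\approx 0.239$. Let $\epsilon>0$ and $\eta<\eta_0-\epsilon$. Let $\alpha\geq \frac{2}{\epsilon}$ be a parameter, and let $X\in\mathbb{R}^{m\times n}$ have i.i.d. $N(0,1)$ entries with \[ m > C\frac{\alpha^2}{\epsilon^2}\, k\log\left(\frac{en}{\alpha^2\epsilon k}\right) \] for a sufficiently large absolute constant $C$. Then with probability $1-e^{-\Omega(\epsilon^2 m)}$ the matrix $X$ has the following property: for any $w^*\in\mathbb{R}^n$ with $\|w^*\|_0\leq k$, any $\zeta\in\mathbb{R}^m$ with $\|\zeta\|_0\leq \eta m$, any $d\in\mathbb{R}^m$, and $y=Xw^*+d+\zeta$, and for any $\lambda\geq\|w^*\|_1$, the estimator \[ \widehat{w} := \operatorname{argmin}_{\|w\|_1\leq\lambda}\|y-Xw\|_1 \] satisfies \[ \|w^*-\widehat{w}\|_2 \leq O\left(\frac{1}{\epsilon-\frac{1}{\alpha}}\cdot\frac{\|d\|_1}{m} + \frac{\lambda-\|w^*\|_1}{\alpha\sqrt{k}}\right), \] where the constant in $O(\cdot)$ is absolute.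
   Context: $\|w\|_0$ denotes the number of nonzero entries of $w$. The vector $\zeta$ represents adversarial sparse corruptions (it may be chosen depending on $X$ and $w^*$), and $d$ is arbitrary (possibly adversarial) dense noise.
   Formalization: The formal theorem adds k ≥ 1 (k is in denominators) and α²εk ≤ n, so that the logarithm is at least 1; without the latter the sample-size condition can be void and the claim false (e.g. m=1, n=2, k=1, α²ε>2e, no noise, λ=‖w*‖₁). *)

theory Defs
  imports "HOL-Probability.Probability"
begin

text \<open>Vectors in R^n are functions nat => real, only indices < n matter.
 Matrices in R^(m x n) are functions nat * nat => real.\<close>

definition std_normal :: "real measure" where
  "std_normal = density lborel std_normal_density"

definition Phi :: "real \<Rightarrow> real" where
  "Phi x = measure std_normal {..x}"

definition eta0 :: real where
  "eta0 = 2 * (1 - Phi (sqrt (2 * ln 2)))"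

definition l0norm :: "nat \<Rightarrow> (nat \<Rightarrow> real) \<Rightarrow> nat" where
  "l0norm n w = card {i. i < n \<and> w i \<noteq> 0}"

definition l1norm :: "nat \<Rightarrow> (nat \<Rightarrow> real) \<Rightarrow> real" where
  "l1norm n w = (\<Sum>i<n. \<bar>w i\<bar>)"

definition l2norm :: "nat \<Rightarrow> (nat \<Rightarrow> real) \<Rightarrow> real" where
  "l2norm n w = sqrt (\<Sum>i<n. (w i)\<^sup>2)"

definition matvec :: "nat \<Rightarrow> (nat \<times> nat \<Rightarrow> real) \<Rightarrow> (nat \<Rightarrow> real) \<Rightarrow> (nat \<Rightarrow> real)" where
  "matvec n X w = (\<lambda>i. \<Sum>j<n. X (i, j) * w j)"

definition gaussian_matrix :: "nat \<Rightarrow> nat \<Rightarrow> (nat \<times> nat \<Rightarrow> real) measure" where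
  "gaussian_matrix m n = PiM ({..<m} \<times> {..<n}) (\<lambda>_. std_normal)"

definition is_l1_argmin ::
  "nat \<Rightarrow> nat \<Rightarrow> (nat \<times> nat \<Rightarrow> real) \<Rightarrow> (nat \<Rightarrow> real) \<Rightarrow> real \<Rightarrow> (nat \<Rightarrow> real) \<Rightarrow> bool" where
  "is_l1_argmin m n X y lam w_hat \<longleftrightarrow>
     l1norm n w_hat \<le> lam \<and>
     (\<forall>w. l1norm n w \<le> lam \<longrightarrow>
        l1norm m (\<lambda>i. y i - matvec n X w_hat i) \<le> l1norm m (\<lambda>i. y i - matvec n X w i))"

end

theory Submission
  imports Defs
begin

text \<open>
  Put \<open>t = sqrt (2 * ln 2)\<close> and \<open>\<psi> x = \<bar>x\<bar> - 2 * max 0 (\<bar>x\<bar> - t)\<close>. If \<open>h\<close> is the error of the estimator,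
  optimality gives \<open>r * (\<Sum>i<m. \<psi> (X h / r)\<^sub>i) \<le> 2 * l1norm d + 2 * r * t * l0norm \<zeta>\<close> for every \<open>r > 0\<close>, so no union
  over the corrupted sets is needed. Since \<open>\<psi>\<close> has mean \<open>2 * t * eta0\<close> under the standard normal law, it
  suffices that the empirical mean of \<open>\<psi>\<close> over the rows is within \<open>t * \<epsilon>\<close> of this, from below, uniformly over
  unit vectors \<open>h\<close> of l1-norm at most \<open>3 * \<alpha> * sqrt k\<close>; every error that is large compared with the
  \<open>\<lambda>\<close>-term is a multiple of such a vector.

  As \<open>\<psi>\<close> is 1-Lipschitz with \<open>\<psi> 0 = 0\<close>, symmetrization and contraction, applied to one row at a time inside
  an exponential moment, replace the deviation of \<open>\<psi>\<close> by the linear process \<open>2 * \<langle>x, h\<rangle>\<close>. The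
  exponential moment of the supremum of the linear process is explicit: with \<open>G\<close> the sum of the rows,
  \<open>\<langle>G, h\<rangle>\<close> is at most \<open>\<tau>\<close> times the l1-norm of \<open>h\<close> plus the l2-norm of the part of \<open>G\<close> exceeding
  \<open>\<tau>\<close>.
\<close>

section \<open>Symmetrization and contraction in an exponential moment\<close>

text \<open>Two-point weak majorization for an increasing convex function. Once both pairs are
  ordered, only \<open>q < v \<le> u \<le> p\<close> needs an argument: the drop from
  \<open>v\<close> to \<open>q\<close> has slope at most \<open>exp v\<close>, the rise from
  \<open>u\<close> to \<open>p\<close> has slope at least \<open>exp u\<close>, and
  \<open>v - q \<le> p - u\<close>.\<close>

lemma exp_add_exp_le_submajorized:
  fixes u v p q :: real
  assumes max: "max u v \<le> max p q" and sum: "u + v \<le> p + q"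
  shows "exp u + exp v \<le> exp p + exp q"
proof -
  have ordered: "exp u + exp v \<le> exp p + exp q"
    if "v \<le> u" "u \<le> p" "u + v \<le> p + q" for u v p q :: real
  proof (cases "v \<le> q")
    case True
    then show ?thesis using that by (intro add_mono) auto
  next
    case False
    have tangent: "exp y * (x - y) \<le> exp x - exp y" for x y :: real
      using mult_left_mono[OF exp_ge_add_one_self[of "x - y"], of "exp y"]
      by (simp add: exp_diff algebra_simps)
    have "exp v - exp q \<le> exp v * (v - q)"
      using tangent[of v q] by (simp add: algebra_simps)
    also have "\<dots> \<le> exp u * (p - u)"
      using that False by (intro mult_mono) auto
    also have "\<dots> \<le> exp p - exp u"
      by (rule tangent)
    finally show ?thesis by simp
  qed
  show ?thesis
    using ordered[of v u p q] ordered[of v u q p] ordered[of u v p q] ordered[of u v q p] max sum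
    by (auto simp: max_def add.commute split: if_splits)
qed

lemma SUP_add_SUP_le:
  fixes f g :: "'a \<Rightarrow> ennreal"
  assumes "I \<noteq> {}" "J \<noteq> {}" "\<And>i j. i \<in> I \<Longrightarrow> j \<in> J \<Longrightarrow> f i + g j \<le> c"
  shows "(SUP i\<in>I. f i) + (SUP j\<in>J. g j) \<le> c"
proof -
  have "(SUP i\<in>I. f i) + g j \<le> c" if "j \<in> J" for j
    using assms that by (simp add: ennreal_SUP_add_left[symmetric] SUP_le_iff)
  then show ?thesis
    using assms by (simp add: add.commute[of "Sup (f ` I)"] ennreal_SUP_add_left[symmetric] SUP_le_iff)
qed

text \<open>One step of the contraction principle, with a random sign averaged over its two values.
  The two suprema on the left may be approached at different indices \<open>h\<close> and
  \<open>h'\<close>, so every pair has to be bounded.\<close>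

lemma exp_contraction:
  fixes a b p :: "'a \<Rightarrow> real"
  assumes H: "H \<noteq> {}"
    and lip: "\<And>h h'. h \<in> H \<Longrightarrow> h' \<in> H \<Longrightarrow> \<bar>p h - p h'\<bar> \<le> \<bar>b h - b h'\<bar>"
    and dom: "\<And>h. h \<in> H \<Longrightarrow> \<bar>p h\<bar> \<le> \<bar>b h\<bar>"
  shows "(SUP h\<in>H. ennreal (exp (a h + p h))) + (SUP h\<in>H. ennreal (exp (a h - p h)))
    \<le> (SUP h\<in>H. ennreal (exp (a h + b h))) + (SUP h\<in>H. ennreal (exp (a h - b h)))"
    (is "_ \<le> ?P + ?Q")
proof (rule SUP_add_SUP_le[OF H H])
  fix h h' assume h: "h \<in> H" "h' \<in> H"
  \<comment> \<open>The pair \<open>(a h + p h, a h' - p h')\<close> is weakly majorized by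
    \<open>(P, Q)\<close>: \<open>dom\<close> bounds the larger entry by \<open>max P Q\<close>, and
    \<open>lip\<close> bounds the sum, the sign of \<open>b h - b h'\<close> deciding which index
    serves \<open>P\<close> and which serves \<open>Q\<close>.\<close>
  define P Q where "P = max (a h + b h) (a h' + b h')" and "Q = max (a h - b h) (a h' - b h')"
  have "exp (a h + p h) + exp (a h' - p h') \<le> exp P + exp Q"
    using lip[OF h] dom[OF h(1)] dom[OF h(2)] unfolding P_def Q_def
    by (intro exp_add_exp_le_submajorized) (auto simp: max_def abs_if split: if_splits)
  then have "ennreal (exp (a h + p h)) + ennreal (exp (a h' - p h')) \<le> ennreal (exp P) + ennreal (exp Q)"
    by (simp flip: ennreal_plus)
  also have "\<dots> \<le> ?P + ?Q"
    unfolding P_def Q_def max_def using h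
    by (intro add_mono) (auto intro: SUP_upper)
  finally show "ennreal (exp (a h + p h)) + ennreal (exp (a h' - p h')) \<le> ?P + ?Q" .
qed

text \<open>Jensen's inequality for \<open>exp\<close>, obtained by integrating the tangent at the
  mean. With a nonnegative integral on the right, \<open>exp (f x)\<close> may have infinite
  mean.\<close>

lemma (in prob_space) exp_expectation_le_nn_integral:
  fixes f :: "'a \<Rightarrow> real"
  assumes f: "integrable M f"
  shows "ennreal (exp (expectation f)) \<le> (\<integral>\<^sup>+x. ennreal (exp (f x)) \<partial>M)"
proof -
  let ?e = "expectation f"
  let ?t = "\<lambda>x. exp ?e * (1 + (f x - ?e))"
  have int: "integrable M ?t"
    using f by (intro integrable_mult_right Bochner_Integration.integrable_add integrable_diff) auto
  have "expectation ?t = exp ?e"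
    using f by (simp add: prob_space)
  then have "ennreal (exp ?e) = ennreal (expectation ?t)"
    by simp
  also have "\<dots> \<le> (\<integral>\<^sup>+x. ennreal (?t x) \<partial>M)"
  proof -
    \<comment> \<open>Conversion to \<open>ennreal\<close> cuts the tangent off at 0, which can only
      raise its integral.\<close>
    have "expectation ?t \<le> expectation (\<lambda>x. max 0 (?t x))"
      using int by (intro integral_mono integrable_max) auto
    then have "ennreal (expectation ?t) \<le> ennreal (expectation (\<lambda>x. max 0 (?t x)))"
      by (rule ennreal_leI)
    also have "\<dots> = (\<integral>\<^sup>+x. ennreal (max 0 (?t x)) \<partial>M)"
      using int by (intro nn_integral_eq_integral[symmetric] integrable_max) auto
    also have "\<dots> = (\<integral>\<^sup>+x. ennreal (?t x) \<partial>M)"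
      by (intro nn_integral_cong) (auto simp: max_def ennreal_neg)
    finally show ?thesis .
  qed
  also have "\<dots> \<le> (\<integral>\<^sup>+x. ennreal (exp (f x)) \<partial>M)"
  proof (intro nn_integral_mono ennreal_leI)
    fix x
    have "?t x \<le> exp ?e * exp (f x - ?e)"
      using exp_ge_add_one_self[of "f x - ?e"] by (intro mult_left_mono) auto
    then show "?t x \<le> exp (f x)"
      by (simp add: exp_diff)
  qed
  finally show ?thesis .
qed

text \<open>Symmetrization without an independent copy of \<open>x\<close>. The arithmetic-geometric
  mean inequality separates the mean from the sample at the price of doubling \<open>l\<close>;
  Jensen turns the mean back into an integral, so that both signs of \<psi> appear; contraction
  removes \<psi>; the reflection \<open>N\<close> makes the two signs contribute equally.\<close>

lemma (in prob_space) symmetrized_contraction: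
  fixes u :: "'h \<Rightarrow> 'a \<Rightarrow> real" and \<psi> :: "real \<Rightarrow> real"
  assumes H: "countable H" "H \<noteq> {}"
    and u [measurable]: "\<And>h. h \<in> H \<Longrightarrow> u h \<in> borel_measurable M"
    and sym: "distr M M N = M" and N [measurable]: "N \<in> measurable M M"
    and odd: "\<And>h x. h \<in> H \<Longrightarrow> x \<in> space M \<Longrightarrow> u h (N x) = - u h x"
    and lip: "\<And>x y. \<bar>\<psi> x - \<psi> y\<bar> \<le> \<bar>x - y\<bar>" and zero: "\<psi> 0 = 0"
    and [measurable]: "\<psi> \<in> borel_measurable borel"
    and int: "\<And>h. h \<in> H \<Longrightarrow> integrable M (\<lambda>x. \<psi> (u h x))"
    and l: "0 \<le> l"
  shows "(\<integral>\<^sup>+x. (SUP h\<in>H. ennreal (exp (a h + l * (expectation (\<lambda>x. \<psi> (u h x)) - \<psi> (u h x))))) \<partial>M)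
    \<le> (\<integral>\<^sup>+x. (SUP h\<in>H. ennreal (exp (a h + 2 * l * u h x))) \<partial>M)" (is "?L \<le> ?R")
proof -
  note [simp] = H
  let ?E = "\<lambda>h. expectation (\<lambda>x. \<psi> (u h x))"
  let ?p = "\<lambda>x. SUP h\<in>H. ennreal (exp (a h + 2 * l * \<psi> (u h x)))"
  let ?n = "\<lambda>x. SUP h\<in>H. ennreal (exp (a h - 2 * l * \<psi> (u h x)))"
  let ?up = "\<lambda>x. SUP h\<in>H. ennreal (exp (a h + 2 * l * u h x))"
  let ?un = "\<lambda>x. SUP h\<in>H. ennreal (exp (a h - 2 * l * u h x))"
  let ?c = "SUP h\<in>H. ennreal (exp (a h + 2 * l * ?E h))"
  have c: "?c \<le> (\<integral>\<^sup>+x. ?p x \<partial>M)"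
  proof (rule SUP_least)
    fix h assume h: "h \<in> H"
    have "a h + 2 * l * ?E h = expectation (\<lambda>x. a h + 2 * l * \<psi> (u h x))"
      using int[OF h] by (simp add: prob_space)
    then have "ennreal (exp (a h + 2 * l * ?E h)) \<le> (\<integral>\<^sup>+x. ennreal (exp (a h + 2 * l * \<psi> (u h x))) \<partial>M)"
      using int[OF h] by (simp only:) (intro exp_expectation_le_nn_integral, simp)
    also have "\<dots> \<le> (\<integral>\<^sup>+x. ?p x \<partial>M)"
      using h by (intro nn_integral_mono) (auto intro: SUP_upper)
    finally show "ennreal (exp (a h + 2 * l * ?E h)) \<le> (\<integral>\<^sup>+x. ?p x \<partial>M)" .
  qed
  have amgm: "(SUP h\<in>H. ennreal (exp (a h + l * (?E h - \<psi> (u h x))))) \<le> ennreal (1/2) * (?c + ?n x)" for x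
  proof (rule SUP_least)
    fix h assume h: "h \<in> H"
    let ?s = "exp ((a h + 2 * l * ?E h) / 2)" and ?t = "exp ((a h - 2 * l * \<psi> (u h x)) / 2)"
    have half: "(exp (z / 2))\<^sup>2 = exp z" for z :: real
      by (simp flip: exp_double)
    have "exp (a h + l * (?E h - \<psi> (u h x))) = ?s * ?t"
      by (simp add: exp_add[symmetric] field_simps)
    also have "\<dots> \<le> 1/2 * (?s\<^sup>2 + ?t\<^sup>2)"
      using sum_squares_bound[of ?s ?t] by simp
    also have "\<dots> = 1/2 * (exp (a h + 2 * l * ?E h) + exp (a h - 2 * l * \<psi> (u h x)))"
      by (simp only: half)
    finally have "ennreal (exp (a h + l * (?E h - \<psi> (u h x))))
        \<le> ennreal (1/2 * (exp (a h + 2 * l * ?E h) + exp (a h - 2 * l * \<psi> (u h x))))"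
      by (rule ennreal_leI)
    also have "\<dots> = ennreal (1/2) * (ennreal (exp (a h + 2 * l * ?E h)) + ennreal (exp (a h - 2 * l * \<psi> (u h x))))"
      by (subst ennreal_mult) auto
    also have "\<dots> \<le> ennreal (1/2) * (?c + ?n x)"
      using h by (intro mult_left_mono add_mono SUP_upper) auto
    finally show "ennreal (exp (a h + l * (?E h - \<psi> (u h x)))) \<le> ennreal (1/2) * (?c + ?n x)" .
  qed
  have "?L \<le> (\<integral>\<^sup>+x. ennreal (1/2) * (?c + ?n x) \<partial>M)"
    by (intro nn_integral_mono amgm)
  also have "\<dots> = ennreal (1/2) * (?c + (\<integral>\<^sup>+x. ?n x \<partial>M))"
    by (simp add: nn_integral_cmult nn_integral_add emeasure_space_1)
  also have "\<dots> \<le> ennreal (1/2) * ((\<integral>\<^sup>+x. ?p x \<partial>M) + (\<integral>\<^sup>+x. ?n x \<partial>M))"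
    using c by (intro mult_left_mono add_mono) auto
  also have "\<dots> = ennreal (1/2) * (\<integral>\<^sup>+x. ?p x + ?n x \<partial>M)"
    by (simp add: nn_integral_add)
  also have "\<dots> \<le> ennreal (1/2) * (\<integral>\<^sup>+x. ?up x + ?un x \<partial>M)"
  \<comment> \<open>Contraction is applied at each fixed \<open>x\<close>:
    \<open>?p x + ?n x\<close> is already the sum over both values of a sign.\<close>
  proof (intro mult_left_mono nn_integral_mono exp_contraction)
    fix x h h'
    have *: "\<bar>2 * l * y - 2 * l * z\<bar> = 2 * l * \<bar>y - z\<bar>" for y z
      using l by (simp add: right_diff_distrib[symmetric] abs_mult)
    show "\<bar>2 * l * \<psi> (u h x) - 2 * l * \<psi> (u h' x)\<bar> \<le> \<bar>2 * l * u h x - 2 * l * u h' x\<bar>"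
      unfolding * using l lip by (intro mult_left_mono) auto
    show "\<bar>2 * l * \<psi> (u h x)\<bar> \<le> \<bar>2 * l * u h x\<bar>"
      using l lip[of "u h x" 0] zero by (simp add: abs_mult mult_left_mono)
  qed auto
  also have "\<dots> = ennreal (1/2) * ((\<integral>\<^sup>+x. ?up x \<partial>M) + (\<integral>\<^sup>+x. ?un x \<partial>M))"
    by (simp add: nn_integral_add)
  \<comment> \<open>\<open>N\<close> preserves the law and flips the sign of every
    \<open>u h\<close>, so \<open>?un\<close> and \<open>?up\<close> have the same integral.\<close>
  also have "(\<integral>\<^sup>+x. ?un x \<partial>M) = (\<integral>\<^sup>+x. ?un x \<partial>distr M M N)"
    by (simp only: sym)
  also have "\<dots> = (\<integral>\<^sup>+x. ?un (N x) \<partial>M)"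
    by (rule nn_integral_distr) auto
  also have "\<dots> = ?R"
    by (intro nn_integral_cong SUP_cong refl) (simp add: odd)
  also have "ennreal (1/2) * (?R + ?R) = ?R"
  proof -
    have "ennreal (1/2) * (r + r) = r" for r :: ennreal
    proof (cases r rule: ennreal_cases)
      case (real q)
      then have "ennreal (1/2) * (r + r) = ennreal (1/2 * (q + q))"
        by (simp only: ennreal_mult ennreal_plus)
      then show ?thesis using real by simp
    qed (simp add: ennreal_mult_top)
    then show ?thesis .
  qed
  finally show ?thesis .
qed

section \<open>Standard normal vectors\<close>

lemma prob_space_std_normal: "prob_space std_normal"
  unfolding std_normal_def by (rule prob_space_normal_density) simp

lemma sets_std_normal [measurable_cong, simp]: "sets std_normal = sets borel"
  by (simp add: std_normal_def)

lemma space_std_normal [simp]: "space std_normal = UNIV"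
  by (simp add: std_normal_def)

lemma distr_uminus_std_normal: "distr std_normal std_normal uminus = std_normal"
proof (rule measure_eqI)
  fix A assume "A \<in> sets (distr std_normal std_normal uminus)"
  then have A [measurable]: "A \<in> sets borel"
    by simp
  have "emeasure (distr std_normal std_normal uminus) A = (\<integral>\<^sup>+x. indicator A x \<partial>distr std_normal std_normal uminus)"
    by simp
  also have "\<dots> = (\<integral>\<^sup>+x. indicator A (- x) \<partial>std_normal)"
    by (rule nn_integral_distr) auto
  also have "\<dots> = (\<integral>\<^sup>+x. ennreal (std_normal_density x) * indicator A (- x) \<partial>lborel)"
    unfolding std_normal_def by (intro nn_integral_density) auto
  also have "\<dots> = (\<integral>\<^sup>+x. ennreal (std_normal_density x) * indicator A x \<partial>lborel)"
    by (subst nn_integral_real_affine[where c = "-1" and t = 0]) (simp_all add: std_normal_density_def)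
  also have "\<dots> = emeasure std_normal A"
    unfolding std_normal_def by (intro emeasure_density[symmetric]) auto
  finally show "emeasure (distr std_normal std_normal uminus) A = emeasure std_normal A" .
qed simp

lemma distr_uminus_PiM_std_normal:
  assumes "finite J"
  shows "distr (PiM J (\<lambda>_. std_normal)) (PiM J (\<lambda>_. std_normal)) (compose J uminus) = PiM J (\<lambda>_. std_normal)"
  using assms distr_PiM_finite_prob_space'[of J "\<lambda>_. std_normal" "\<lambda>_. std_normal" uminus]
  by (simp add: prob_space_std_normal distr_uminus_std_normal)

lemma indep_vars_PiM_std_normal:
  assumes "J \<noteq> {}"
  shows "prob_space.indep_vars (PiM J (\<lambda>_. std_normal)) (\<lambda>_. borel) (\<lambda>j x. x j) J"
proof -
  interpret prob_space "PiM J (\<lambda>_. std_normal)"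
    by (intro prob_space_PiM prob_space_std_normal)
  have comp: "distr (PiM J (\<lambda>_. std_normal)) std_normal (\<lambda>x. x j) = std_normal" if "j \<in> J" for j
    using that by (intro distr_PiM_component prob_space_std_normal) auto
  have id: "distr (PiM J (\<lambda>_. std_normal)) (PiM J (\<lambda>_. std_normal)) (\<lambda>x. \<lambda>j\<in>J. x j) = PiM J (\<lambda>_. std_normal)"
    by (subst distr_cong[where g = "\<lambda>x. x"]) (auto simp: space_PiM)
  have "indep_vars (\<lambda>_. std_normal) (\<lambda>j x. x j) J"
    using assms comp id by (subst indep_vars_iff_distr_eq_PiM') (auto intro!: PiM_cong)
  then show ?thesis
    by (simp add: indep_vars_def cong: measurable_cong_sets)
qed

lemma distributed_PiM_std_normal_component:
  assumes "j \<in> J"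
  shows "distributed (PiM J (\<lambda>_. std_normal)) lborel (\<lambda>x. x j) std_normal_density"
proof -
  have "distr (PiM J (\<lambda>_. std_normal)) lborel (\<lambda>x. x j) = distr (PiM J (\<lambda>_. std_normal)) std_normal (\<lambda>x. x j)"
    by (intro distr_cong) auto
  also have "\<dots> = std_normal"
    using assms by (intro distr_PiM_component prob_space_std_normal) auto
  finally show ?thesis
    using assms by (auto simp: distributed_def std_normal_def)
qed

lemma distributed_PiM_std_normal_linear:
  assumes J: "finite J" and sub: "B \<subseteq> J" and nz: "\<exists>j\<in>B. w j \<noteq> 0"
  shows "distributed (PiM J (\<lambda>_. std_normal)) lborel (\<lambda>x. \<Sum>j\<in>B. x j * w j)
    (normal_density 0 (sqrt (\<Sum>j\<in>B. (w j)\<^sup>2)))"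
proof -
  interpret prob_space "PiM J (\<lambda>_. std_normal)"
    by (intro prob_space_PiM prob_space_std_normal)
  \<comment> \<open>\<open>sum_indep_normal\<close> asks for positive standard deviations, so
    indices of weight 0 are dropped first.\<close>
  define S where "S = {j\<in>B. w j \<noteq> 0}"
  have S: "finite S" "S \<noteq> {}" "S \<subseteq> J" and fB: "finite B"
    using assms finite_subset[OF sub J] by (auto simp: S_def)
  have "indep_vars (\<lambda>_. borel) (\<lambda>j x. x j) S"
    using S indep_vars_PiM_std_normal[of J] by (intro indep_vars_subset[where I = J and J = S]) auto
  then have indep: "indep_vars (\<lambda>_. borel) (\<lambda>j x. x j * w j) S"
    by (rule indep_vars_compose2[where Y = "\<lambda>j y. y * w j"]) auto
  have dist: "distributed (PiM J (\<lambda>_. std_normal)) lborel (\<lambda>x. x j * w j) (normal_density 0 \<bar>w j\<bar>)" if "j \<in> S" for j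
    using normal_density_affine[OF distributed_PiM_std_normal_component[of j J], of "w j" 0] that S
    by (auto simp: S_def mult.commute)
  have "distributed (PiM J (\<lambda>_. std_normal)) lborel (\<lambda>x. \<Sum>j\<in>S. x j * w j)
      (normal_density (\<Sum>j\<in>S. 0) (sqrt (\<Sum>j\<in>S. \<bar>w j\<bar>\<^sup>2)))"
    by (rule sum_indep_normal[OF S(1,2) indep _ dist]) (auto simp: S_def)
  moreover have "(\<Sum>j\<in>S. x j * w j) = (\<Sum>j\<in>B. x j * w j)" for x :: "'a \<Rightarrow> real"
    unfolding S_def using fB by (intro sum.mono_neutral_left) auto
  moreover have "(\<Sum>j\<in>S. \<bar>w j\<bar>\<^sup>2) = (\<Sum>j\<in>B. (w j)\<^sup>2)"
    unfolding S_def using fB by (simp, intro sum.mono_neutral_left) auto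
  ultimately show ?thesis
    by simp
qed

section \<open>Exponential moment of the squared excess over a threshold\<close>

lemma nn_integral_normal_density: "0 < \<sigma> \<Longrightarrow> (\<integral>\<^sup>+x. ennreal (normal_density \<mu> \<sigma> x) \<partial>lborel) = 1"
  by (subst nn_integral_eq_integral) (auto simp: integral_normal_density)

text \<open>Where the excess is positive, the combined exponent is at most that of a normal density
  of variance \<open>2 * \<sigma>\<^sup>2\<close> centred at \<tau> or \<open>-\<tau>\<close>,
  shifted by \<open>- \<tau>\<^sup>2 / (2 * \<sigma>\<^sup>2)\<close>. The factor
  \<open>sqrt 2\<close> adjusts the normalization. Elsewhere the first summand suffices.\<close>

lemma normal_exp_excess_density_le:
  fixes x \<sigma> \<tau> :: real
  assumes \<sigma>: "0 < \<sigma>" and \<tau>: "0 \<le> \<tau>"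
  shows "normal_density 0 \<sigma> x * exp ((max 0 (\<bar>x\<bar> - \<tau>))\<^sup>2 / (4 * \<sigma>\<^sup>2)) \<le>
    normal_density 0 \<sigma> x + sqrt 2 * exp (- \<tau>\<^sup>2 / (2 * \<sigma>\<^sup>2)) *
      (normal_density \<tau> (sqrt 2 * \<sigma>) x + normal_density (-\<tau>) (sqrt 2 * \<sigma>) x)" (is "?l \<le> ?n + ?c * (?p + ?q)")
proof (cases "\<bar>x\<bar> \<le> \<tau>")
  case True
  then show ?thesis by simp
next
  case False
  \<comment> \<open>Here \<open>z\<close> stands for \<open>\<bar>x\<bar>\<close>, and
    \<open>y\<close> is whichever of \<tau> and \<open>-\<tau>\<close> lies on the side of
    \<open>x\<close>.\<close>
  have key: "normal_density 0 \<sigma> x * exp ((z - \<tau>)\<^sup>2 / (4 * \<sigma>\<^sup>2)) \<le> ?c * normal_density y (sqrt 2 * \<sigma>) x"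
    if z: "\<tau> \<le> z" "z\<^sup>2 = x\<^sup>2" "(x - y)\<^sup>2 = (z - \<tau>)\<^sup>2" for z y
  proof -
    have "- x\<^sup>2 / (2 * \<sigma>\<^sup>2) + (z - \<tau>)\<^sup>2 / (4 * \<sigma>\<^sup>2) = (- 2 * z\<^sup>2 + (z - \<tau>)\<^sup>2) / (4 * \<sigma>\<^sup>2)"
      using \<sigma> z by (simp add: field_simps)
    also have "\<dots> \<le> (- 2 * \<tau>\<^sup>2 - (z - \<tau>)\<^sup>2) / (4 * \<sigma>\<^sup>2)"
    proof (intro divide_right_mono)
      have "0 \<le> 4 * \<tau> * (z - \<tau>)" using z \<tau> by simp
      then show "- 2 * z\<^sup>2 + (z - \<tau>)\<^sup>2 \<le> - 2 * \<tau>\<^sup>2 - (z - \<tau>)\<^sup>2"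
        by (simp add: power2_eq_square algebra_simps)
    qed simp
    also have "\<dots> = - \<tau>\<^sup>2 / (2 * \<sigma>\<^sup>2) + - (x - y)\<^sup>2 / (2 * (sqrt 2 * \<sigma>)\<^sup>2)"
      using \<sigma> z by (simp add: field_simps power_mult_distrib)
    finally have "exp (- x\<^sup>2 / (2 * \<sigma>\<^sup>2)) * exp ((z - \<tau>)\<^sup>2 / (4 * \<sigma>\<^sup>2))
        \<le> exp (- \<tau>\<^sup>2 / (2 * \<sigma>\<^sup>2)) * exp (- (x - y)\<^sup>2 / (2 * (sqrt 2 * \<sigma>)\<^sup>2))"
      by (simp only: exp_add[symmetric] exp_le_cancel_iff)
    then have "1 / sqrt (2 * pi * \<sigma>\<^sup>2) * (exp (- x\<^sup>2 / (2 * \<sigma>\<^sup>2)) * exp ((z - \<tau>)\<^sup>2 / (4 * \<sigma>\<^sup>2)))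
        \<le> 1 / sqrt (2 * pi * \<sigma>\<^sup>2) * (exp (- \<tau>\<^sup>2 / (2 * \<sigma>\<^sup>2)) * exp (- (x - y)\<^sup>2 / (2 * (sqrt 2 * \<sigma>)\<^sup>2)))"
      by (intro mult_left_mono) auto
    moreover have s2: "sqrt 2 * (sqrt 2 * r) = 2 * r" for r :: real
      by (simp flip: mult.assoc)
    ultimately show ?thesis
      using \<sigma> by (simp add: s2 normal_density_def real_sqrt_mult power_mult_distrib field_simps)
  qed
  have nonneg: "0 \<le> ?n" "0 \<le> ?c * ?p" "0 \<le> ?c * ?q"
    by auto
  show ?thesis
  proof (cases "x \<ge> 0")
    case True
    then have "?l \<le> ?c * ?p"
      using False key[of x \<tau>] by (simp add: max_def)
    then show ?thesis using nonneg by (simp only: distrib_left)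
  next
    case x: False
    then have "?l \<le> ?c * ?q"
      using False key[of "-x" "-\<tau>"] by (simp add: max_def power2_eq_square algebra_simps)
    then show ?thesis using nonneg by (simp only: distrib_left)
  qed
qed

text \<open>Integrating the pointwise bound leaves only total masses of normal densities. Measuring
  the threshold in units of \<sigma> makes the result independent of \<sigma>.\<close>

lemma normal_exp_excess_le:
  assumes "distributed M lborel g (normal_density 0 \<sigma>)" and \<sigma>: "0 < \<sigma>" and \<theta>: "0 \<le> \<theta>"
  shows "(\<integral>\<^sup>+x. ennreal (exp ((max 0 (\<bar>g x\<bar> - \<sigma> * \<theta>))\<^sup>2 / (4 * \<sigma>\<^sup>2))) \<partial>M) \<le>
    ennreal (1 + 2 * sqrt 2 * exp (- \<theta>\<^sup>2 / 2))"
proof -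
  let ?c = "sqrt 2 * exp (- (\<sigma> * \<theta>)\<^sup>2 / (2 * \<sigma>\<^sup>2))"
  have "(\<integral>\<^sup>+x. ennreal (exp ((max 0 (\<bar>g x\<bar> - \<sigma> * \<theta>))\<^sup>2 / (4 * \<sigma>\<^sup>2))) \<partial>M) =
    (\<integral>\<^sup>+x. ennreal (normal_density 0 \<sigma> x) * ennreal (exp ((max 0 (\<bar>x\<bar> - \<sigma> * \<theta>))\<^sup>2 / (4 * \<sigma>\<^sup>2))) \<partial>lborel)"
    by (rule distributed_nn_integral[OF assms(1), symmetric]) simp
  also have "\<dots> \<le> (\<integral>\<^sup>+x. ennreal (normal_density 0 \<sigma> x) + ennreal ?c *
      (ennreal (normal_density (\<sigma> * \<theta>) (sqrt 2 * \<sigma>) x) + ennreal (normal_density (- (\<sigma> * \<theta>)) (sqrt 2 * \<sigma>) x)) \<partial>lborel)"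
    using normal_exp_excess_density_le[OF \<sigma>, of "\<sigma> * \<theta>"] \<sigma> \<theta>
    by (intro nn_integral_mono) (simp flip: ennreal_plus ennreal_mult)
  also have "\<dots> = 1 + ennreal ?c * (1 + 1)"
    using \<sigma> by (simp add: nn_integral_add nn_integral_cmult nn_integral_normal_density)
  also have "\<dots> = ennreal (1 + ?c * 2)"
    by (simp add: ennreal_plus ennreal_mult)
  also have "1 + ?c * 2 = 1 + 2 * sqrt 2 * exp (- \<theta>\<^sup>2 / 2)"
    using \<sigma> by (simp add: power_mult_distrib)
  finally show ?thesis .
qed

section \<open>The folded absolute value\<close>

text \<open>This is the minimum of \<open>\<bar>x\<bar>\<close> and
  \<open>2 * t - \<bar>x\<bar>\<close>: an intact entry raises the l1 objective by
  \<open>\<bar>x\<bar>\<close>, while a corrupted one may lower it by \<open>\<bar>x\<bar>\<close>,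
  and the adversary pays \<open>2 * t\<close> for the corruption. The slopes are all 1 or
  -1.\<close>

definition folded_abs :: "real \<Rightarrow> real \<Rightarrow> real" where
  "folded_abs t x = \<bar>x\<bar> - 2 * max 0 (\<bar>x\<bar> - t)"

lemma folded_abs_lipschitz: "\<bar>folded_abs t x - folded_abs t y\<bar> \<le> \<bar>x - y\<bar>"
  by (auto simp: folded_abs_def max_def abs_if)

lemma folded_abs_0: "0 \<le> t \<Longrightarrow> folded_abs t 0 = 0"
  by (simp add: folded_abs_def)

lemma borel_measurable_folded_abs [measurable]: "folded_abs t \<in> borel_measurable borel"
  unfolding folded_abs_def by measurable

lemma folded_abs_scale: "0 \<le> c \<Longrightarrow> c * folded_abs t x = folded_abs (c * t) (c * x)"
  by (auto simp: folded_abs_def abs_mult max_def right_diff_distrib mult_le_cancel_left)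

text \<open>\<open>- std_normal_density\<close> is an antiderivative of the integrand and vanishes
  at infinity.\<close>

lemma has_bochner_integral_normal_tail_mean:
  assumes t: "0 \<le> t"
  shows "has_bochner_integral lborel (\<lambda>x. std_normal_density x * x * indicator {t..} x) (std_normal_density t)"
proof (rule has_bochner_integral_nn_integral)
  have "(\<integral>\<^sup>+x. ennreal (std_normal_density x * x) * indicator {t..} x \<partial>lborel) = ennreal (0 - (- std_normal_density t))"
  proof (rule nn_integral_FTC_atLeast)
    fix x assume "t \<le> x"
    then show "0 \<le> std_normal_density x * x" using t by simp
    show "((\<lambda>x. - std_normal_density x) has_real_derivative std_normal_density x * x) (at x)"
      unfolding std_normal_density_def by (auto intro!: derivative_eq_intros simp: field_simps)
  next
    have "((\<lambda>x::real. exp (- x\<^sup>2 / 2)) \<longlongrightarrow> 0) at_top"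
      by real_asymp
    from tendsto_minus[OF tendsto_mult_right_zero[OF this, of "1 / sqrt (2 * pi)"]]
    show "((\<lambda>x. - std_normal_density x) \<longlongrightarrow> 0) at_top"
      unfolding std_normal_density_def by simp
  qed simp
  also have "(\<integral>\<^sup>+x. ennreal (std_normal_density x * x) * indicator {t..} x \<partial>lborel) =
      (\<integral>\<^sup>+x. ennreal (std_normal_density x * x * indicator {t..} x) \<partial>lborel)"
    by (intro nn_integral_cong) (auto simp: indicator_def)
  finally show "(\<integral>\<^sup>+x. ennreal (std_normal_density x * x * indicator {t..} x) \<partial>lborel) = ennreal (std_normal_density t)"
    by simp
qed (use t in \<open>auto simp: indicator_def\<close>)

lemma has_bochner_integral_normal_tail:
  "has_bochner_integral lborel (\<lambda>x. std_normal_density x * indicator {t<..} x) (1 - Phi t)"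
proof (rule has_bochner_integral_nn_integral)
  interpret prob_space std_normal by (rule prob_space_std_normal)
  have "(\<integral>\<^sup>+x. ennreal (std_normal_density x * indicator {t<..} x) \<partial>lborel) =
      (\<integral>\<^sup>+x. ennreal (std_normal_density x) * indicator {t<..} x \<partial>lborel)"
    by (intro nn_integral_cong) (auto simp: indicator_def)
  also have "\<dots> = emeasure std_normal {t<..}"
    unfolding std_normal_def by (intro emeasure_density[symmetric]) auto
  also have "\<dots> = emeasure std_normal (space std_normal - {..t})"
    by (intro arg_cong[where f = "emeasure std_normal"]) auto
  also have "\<dots> = ennreal (1 - Phi t)"
    unfolding emeasure_eq_measure Phi_def by (subst prob_compl) auto
  finally show "(\<integral>\<^sup>+x. ennreal (std_normal_density x * indicator {t<..} x) \<partial>lborel) = ennreal (1 - Phi t)" .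
  show "0 \<le> 1 - Phi t"
    unfolding Phi_def by simp
qed auto

lemma has_bochner_integral_normal_excess:
  assumes t: "0 \<le> t"
  shows "has_bochner_integral lborel (\<lambda>x. std_normal_density x * max 0 (\<bar>x\<bar> - t))
    (2 * (std_normal_density t - t * (1 - Phi t)))"
proof -
  let ?f = "\<lambda>x. std_normal_density x * max 0 (x - t)" and ?I = "std_normal_density t - t * (1 - Phi t)"
  have "has_bochner_integral lborel (\<lambda>x. std_normal_density x * x * indicator {t..} x
      - t * (std_normal_density x * indicator {t<..} x)) ?I"
    by (intro has_bochner_integral_diff has_bochner_integral_mult_right
        has_bochner_integral_normal_tail_mean has_bochner_integral_normal_tail t)
  \<comment> \<open>One half-line is closed and the other open, so the two sides can differ only at
    the null set \<open>{t}\<close>.\<close>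
  moreover have "AE x in lborel. std_normal_density x * x * indicator {t..} x
      - t * (std_normal_density x * indicator {t<..} x) = ?f x"
    using AE_lborel_singleton[of t] by eventually_elim (auto simp: indicator_def max_def algebra_simps)
  ultimately have f: "has_bochner_integral lborel ?f ?I"
    by (subst (asm) has_bochner_integral_cong_AE) auto
  then have "has_bochner_integral lborel (\<lambda>x. ?f (0 + (-1) * x)) (?I /\<^sub>R \<bar>-1\<bar>)"
    by (intro lborel_has_bochner_integral_real_affine_iff[THEN iffD1]) auto
  then have g: "has_bochner_integral lborel (\<lambda>x. ?f (- x)) ?I"
    by simp
  \<comment> \<open>Since \<open>t\<close> is nonnegative, the two one-sided excesses are never
    positive together.\<close>
  have eq: "?f x + ?f (- x) = std_normal_density x * max 0 (\<bar>x\<bar> - t)" for x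
    using t by (auto simp: std_normal_density_def max_def abs_if)
  show ?thesis
    using has_bochner_integral_add[OF f g] unfolding eq mult_2 .
qed

text \<open>The threshold makes the two exponential terms cancel: \<open>exp (- t\<^sup>2 / 2) = 1 / 2\<close>.\<close>

lemma has_bochner_integral_folded_abs:
  defines "t \<equiv> sqrt (2 * ln 2)"
  shows "has_bochner_integral lborel (\<lambda>x. std_normal_density x * folded_abs t x) (2 * t * eta0)"
proof -
  have t: "0 \<le> t" "t\<^sup>2 = 2 * ln 2"
    by (simp_all add: t_def)
  have dens: "std_normal_density t = 1 / 2 * (1 / sqrt (2 * pi))"
    unfolding std_normal_density_def using t by (simp add: exp_minus)
  have "has_bochner_integral lborel (\<lambda>x. std_normal_density x * \<bar>x\<bar> - 2 * (std_normal_density x * max 0 (\<bar>x\<bar> - t)))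
      (sqrt (2 / pi) - 2 * (2 * (std_normal_density t - t * (1 - Phi t))))"
    using std_normal_moment_abs_odd[of 0]
    by (intro has_bochner_integral_diff has_bochner_integral_mult_right has_bochner_integral_normal_excess t) simp
  moreover have "sqrt (2 / pi) = 2 / sqrt (2 * pi)"
    by (simp add: real_sqrt_mult real_sqrt_divide field_simps)
  then have "sqrt (2 / pi) - 2 * (2 * (std_normal_density t - t * (1 - Phi t))) = 2 * t * eta0"
    unfolding dens eta0_def t_def[symmetric] by (simp add: algebra_simps)
  ultimately show ?thesis
    by (simp add: folded_abs_def algebra_simps)
qed

section \<open>Gaussian matrices\<close>

lemma measurable_matvec [measurable]:
  assumes "{i} \<times> {..<n} \<subseteq> K"
  shows "(\<lambda>X. matvec n X h i) \<in> borel_measurable (PiM K (\<lambda>_. std_normal))"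
proof -
  have "(\<lambda>X. X (i, j)) \<in> borel_measurable (PiM K (\<lambda>_. std_normal))" if "j < n" for j
    using assms that measurable_component_singleton[of "(i, j)" K "\<lambda>_. std_normal"]
    by (auto cong: measurable_cong_sets)
  then show ?thesis
    unfolding matvec_def by measurable
qed

lemma distributed_matvec:
  assumes K: "finite K" "{i} \<times> {..<n} \<subseteq> K" and h: "l2norm n h = 1"
  shows "distributed (PiM K (\<lambda>_. std_normal)) lborel (\<lambda>X. matvec n X h i) std_normal_density"
proof -
  let ?w = "\<lambda>p. h (snd p)"
  have h2: "(\<Sum>j<n. (h j)\<^sup>2) = 1"
    using h by (simp add: l2norm_def)
  have sum: "(\<Sum>p\<in>{i} \<times> {..<n}. g p) = (\<Sum>j<n. g (i, j))" for g :: "nat \<times> nat \<Rightarrow> real"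
    by (rule sum.reindex_bij_witness[of _ "\<lambda>j. (i, j)" snd]) auto
  have "\<exists>p\<in>{i} \<times> {..<n}. ?w p \<noteq> 0"
    using h2 by (auto intro: ccontr)
  from distributed_PiM_std_normal_linear[OF K this]
  show ?thesis
    by (simp add: sum h2 matvec_def)
qed

lemma matvec_merge_left:
  "{i} \<times> {..<n} \<subseteq> I \<Longrightarrow> matvec n (merge I J (x, y)) h i = matvec n x h i"
  by (auto simp: matvec_def merge_def intro!: sum.cong)

lemma matvec_merge_right:
  assumes "{i} \<times> {..<n} \<subseteq> J" "I \<inter> J = {}"
  shows "matvec n (merge I J (x, y)) h i = matvec n y h i"
proof -
  have "(i, j) \<in> J \<and> (i, j) \<notin> I" if "j < n" for j
    using assms that by blast
  then show ?thesis
    by (simp add: matvec_def merge_def)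
qed

text \<open>Induction on the rows. The offset \<open>a\<close> is arbitrary because it has to absorb
  the contribution of whichever rows are held fixed. Fubini is used in both orders: with the last
  row innermost for the one-row step, then with the first \<open>m\<close> rows innermost for the
  induction hypothesis.\<close>

lemma gaussian_matrix_contraction:
  fixes H :: "(nat \<Rightarrow> real) set" and \<psi> :: "real \<Rightarrow> real"
  assumes H: "countable H" "H \<noteq> {}"
    and lip: "\<And>x y. \<bar>\<psi> x - \<psi> y\<bar> \<le> \<bar>x - y\<bar>" and zero: "\<psi> 0 = 0"
    and \<psi> [measurable]: "\<psi> \<in> borel_measurable borel"
    and E: "\<And>h i. h \<in> H \<Longrightarrow>
      has_bochner_integral (PiM ({i} \<times> {..<n}) (\<lambda>_. std_normal)) (\<lambda>X. \<psi> (matvec n X h i)) (E h)"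
    and l: "0 \<le> l"
  shows "(\<integral>\<^sup>+X. (SUP h\<in>H. ennreal (exp (a h + (\<Sum>i<m. l * (E h - \<psi> (matvec n X h i)))))) \<partial>gaussian_matrix m n)
    \<le> (\<integral>\<^sup>+X. (SUP h\<in>H. ennreal (exp (a h + (\<Sum>i<m. 2 * l * matvec n X h i)))) \<partial>gaussian_matrix m n)"
proof (induction m arbitrary: a)
  case 0
  show ?case by simp
next
  case (Suc m)
  note [simp] = H
  interpret product_prob_space "\<lambda>_. std_normal" "{..<Suc m} \<times> {..<n}"
    by (simp add: product_prob_space_def product_prob_space_axioms_def product_sigma_finite_def
        prob_space_std_normal prob_space_imp_sigma_finite)
  define I J where "I = {..<m} \<times> {..<n}" and "J = {m} \<times> {..<n}"
  have fin: "finite I" "finite J" and disj: "I \<inter> J = {}" "J \<inter> I = {}" and un: "{..<Suc m} \<times> {..<n} = I \<union> J"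
    by (auto simp: I_def J_def less_Suc_eq)
  have rowI: "{i} \<times> {..<n} \<subseteq> I" if "i < m" for i
    using that by (auto simp: I_def)
  have rowJ: "{m} \<times> {..<n} \<subseteq> J"
    by (simp add: J_def)
  have meas [measurable]: "(\<lambda>X. matvec n X h i) \<in> borel_measurable (PiM (I \<union> J) (\<lambda>_. std_normal))" if "i < Suc m" for h i
    using that un by (intro measurable_matvec) auto
  have gm: "gaussian_matrix (Suc m) n = PiM (I \<union> J) (\<lambda>_. std_normal)" "gaussian_matrix m n = PiM I (\<lambda>_. std_normal)"
    by (simp_all add: gaussian_matrix_def un I_def)
  interpret J: prob_space "PiM J (\<lambda>_. std_normal)"
    by (intro prob_space_PiM prob_space_std_normal)
  have EJ: "integrable (PiM J (\<lambda>_. std_normal)) (\<lambda>X. \<psi> (matvec n X h m))"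
      "J.expectation (\<lambda>X. \<psi> (matvec n X h m)) = E h" if "h \<in> H" for h
    using E[OF that, of m] unfolding J_def by (simp_all add: has_bochner_integral_iff)
  \<comment> \<open>A single row is a symmetric vector on which every \<open>matvec n y h m\<close>
    is odd, so negating all its entries serves as the reflection.\<close>
  have row: "(\<integral>\<^sup>+y. (SUP h\<in>H. ennreal (exp (b h + l * (E h - \<psi> (matvec n y h m))))) \<partial>PiM J (\<lambda>_. std_normal))
      \<le> (\<integral>\<^sup>+y. (SUP h\<in>H. ennreal (exp (b h + 2 * l * matvec n y h m))) \<partial>PiM J (\<lambda>_. std_normal))" for b
  proof -
    have "(\<integral>\<^sup>+y. (SUP h\<in>H. ennreal (exp (b h + l * (E h - \<psi> (matvec n y h m))))) \<partial>PiM J (\<lambda>_. std_normal)) =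
       (\<integral>\<^sup>+y. (SUP h\<in>H. ennreal (exp (b h + l * (J.expectation (\<lambda>X. \<psi> (matvec n X h m)) - \<psi> (matvec n y h m)))))
          \<partial>PiM J (\<lambda>_. std_normal))"
      by (intro nn_integral_cong SUP_cong refl) (simp add: EJ)
    also have "\<dots> \<le> (\<integral>\<^sup>+y. (SUP h\<in>H. ennreal (exp (b h + 2 * l * matvec n y h m))) \<partial>PiM J (\<lambda>_. std_normal))"
    proof (rule J.symmetrized_contraction[where N = "compose J uminus"])
      show "distr (PiM J (\<lambda>_. std_normal)) (PiM J (\<lambda>_. std_normal)) (compose J uminus) = PiM J (\<lambda>_. std_normal)"
        using fin(2) by (rule distr_uminus_PiM_std_normal)
      show "compose J uminus \<in> measurable (PiM J (\<lambda>_. std_normal)) (PiM J (\<lambda>_. std_normal))"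
        unfolding compose_def by measurable
      show "matvec n (compose J uminus x) h m = - matvec n x h m" for x h
        using rowJ by (auto simp: matvec_def compose_def sum_negf[symmetric] intro!: sum.cong)
    qed (use rowJ EJ lip zero l in \<open>auto intro: measurable_matvec\<close>)
    finally show ?thesis .
  qed
  have "(\<integral>\<^sup>+X. (SUP h\<in>H. ennreal (exp (a h + (\<Sum>i<Suc m. l * (E h - \<psi> (matvec n X h i)))))) \<partial>gaussian_matrix (Suc m) n)
    = (\<integral>\<^sup>+x. (\<integral>\<^sup>+y. (SUP h\<in>H. ennreal (exp (a h + (\<Sum>i<Suc m. l * (E h - \<psi> (matvec n (merge I J (x, y)) h i))))))
          \<partial>PiM J (\<lambda>_. std_normal)) \<partial>PiM I (\<lambda>_. std_normal))"
    unfolding gm by (intro product_nn_integral_fold disj fin) measurable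
  also have "\<dots> = (\<integral>\<^sup>+x. (\<integral>\<^sup>+y. (SUP h\<in>H. ennreal (exp ((a h + (\<Sum>i<m. l * (E h - \<psi> (matvec n x h i)))) + l * (E h - \<psi> (matvec n y h m)))))
          \<partial>PiM J (\<lambda>_. std_normal)) \<partial>PiM I (\<lambda>_. std_normal))"
    by (simp add: matvec_merge_left[OF rowI] matvec_merge_right[OF rowJ disj(1)] add.assoc)
  also have "\<dots> \<le> (\<integral>\<^sup>+x. (\<integral>\<^sup>+y. (SUP h\<in>H. ennreal (exp ((a h + (\<Sum>i<m. l * (E h - \<psi> (matvec n x h i)))) + 2 * l * matvec n y h m)))
          \<partial>PiM J (\<lambda>_. std_normal)) \<partial>PiM I (\<lambda>_. std_normal))"
    by (intro nn_integral_mono row)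
  also have "\<dots> = (\<integral>\<^sup>+x. (\<integral>\<^sup>+y. (SUP h\<in>H. ennreal (exp (a h + (\<Sum>i<m. l * (E h - \<psi> (matvec n (merge I J (x, y)) h i)))
             + 2 * l * matvec n (merge I J (x, y)) h m)))
          \<partial>PiM J (\<lambda>_. std_normal)) \<partial>PiM I (\<lambda>_. std_normal))"
    by (simp add: matvec_merge_left[OF rowI] matvec_merge_right[OF rowJ disj(1)])
  also have "\<dots> = (\<integral>\<^sup>+X. (SUP h\<in>H. ennreal (exp (a h + (\<Sum>i<m. l * (E h - \<psi> (matvec n X h i))) + 2 * l * matvec n X h m)))
          \<partial>PiM (I \<union> J) (\<lambda>_. std_normal))"
    by (intro product_nn_integral_fold[symmetric] disj fin) measurable
  \<comment> \<open>The last row is linear by now; the order of integration is exchanged to reach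
    the remaining rows.\<close>
  also have "\<dots> = (\<integral>\<^sup>+y. (\<integral>\<^sup>+x. (SUP h\<in>H. ennreal (exp (a h + (\<Sum>i<m. l * (E h - \<psi> (matvec n (merge J I (y, x)) h i)))
             + 2 * l * matvec n (merge J I (y, x)) h m)))
          \<partial>PiM I (\<lambda>_. std_normal)) \<partial>PiM J (\<lambda>_. std_normal))"
    unfolding Un_commute[of I J]
    by (intro product_nn_integral_fold disj fin) (use meas in \<open>simp add: Un_commute[of I J], measurable\<close>)
  also have "\<dots> = (\<integral>\<^sup>+y. (\<integral>\<^sup>+x. (SUP h\<in>H. ennreal (exp ((a h + 2 * l * matvec n y h m) + (\<Sum>i<m. l * (E h - \<psi> (matvec n x h i))))))
          \<partial>PiM I (\<lambda>_. std_normal)) \<partial>PiM J (\<lambda>_. std_normal))"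
    by (simp add: matvec_merge_left[OF rowJ] matvec_merge_right[OF rowI disj(2)] ac_simps)
  also have "\<dots> \<le> (\<integral>\<^sup>+y. (\<integral>\<^sup>+x. (SUP h\<in>H. ennreal (exp ((a h + 2 * l * matvec n y h m) + (\<Sum>i<m. 2 * l * matvec n x h i))))
          \<partial>PiM I (\<lambda>_. std_normal)) \<partial>PiM J (\<lambda>_. std_normal))"
    \<comment> \<open>The offset of the induction hypothesis is
      \<open>a h + 2 * l * matvec n y h m\<close>, with \<open>y\<close> fixed.\<close>
    by (rule nn_integral_mono, rule Suc.IH[unfolded gm])
  also have "\<dots> = (\<integral>\<^sup>+y. (\<integral>\<^sup>+x. (SUP h\<in>H. ennreal (exp (a h + (\<Sum>i<Suc m. 2 * l * matvec n (merge J I (y, x)) h i))))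
          \<partial>PiM I (\<lambda>_. std_normal)) \<partial>PiM J (\<lambda>_. std_normal))"
    by (simp add: matvec_merge_left[OF rowJ] matvec_merge_right[OF rowI disj(2)] ac_simps)
  also have "\<dots> = (\<integral>\<^sup>+X. (SUP h\<in>H. ennreal (exp (a h + (\<Sum>i<Suc m. 2 * l * matvec n X h i)))) \<partial>gaussian_matrix (Suc m) n)"
    unfolding gm Un_commute[of I J]
    by (intro product_nn_integral_fold[symmetric] disj fin) (use meas in \<open>simp add: Un_commute[of I J], measurable\<close>)
  finally show ?case .
qed

section \<open>Exponential moment of the supremum of the linear process\<close>

lemma cauchy_schwarz_l2norm:
  assumes "S \<subseteq> {..<n}"
  shows "(\<Sum>j\<in>S. \<bar>v j\<bar> * \<bar>h j\<bar>) \<le> sqrt (\<Sum>j\<in>S. (v j)\<^sup>2) * l2norm n h"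
proof -
  have "(\<Sum>j\<in>S. \<bar>v j\<bar> * \<bar>h j\<bar>) \<le> sqrt (\<Sum>j\<in>S. (v j)\<^sup>2) * sqrt (\<Sum>j\<in>S. (h j)\<^sup>2)"
    using L2_set_mult_ineq[of v h S] by (simp add: L2_set_def)
  also have "\<dots> \<le> sqrt (\<Sum>j\<in>S. (v j)\<^sup>2) * l2norm n h"
    unfolding l2norm_def using assms
    by (intro mult_left_mono real_sqrt_le_mono sum_mono2) (auto intro: real_sqrt_ge_zero sum_nonneg)
  finally show ?thesis .
qed

text \<open>Entries of \<open>G\<close> below the threshold \<open>\<tau>\<close> are paid for by the l1-norm of \<open>h\<close>, the excess by its l2-norm.\<close>

lemma inner_le_threshold:
  assumes "l1norm n h \<le> s" "l2norm n h \<le> 1" "0 \<le> \<tau>"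
  shows "(\<Sum>j<n. G j * h j) \<le> s * \<tau> + sqrt (\<Sum>j<n. (max 0 (\<bar>G j\<bar> - \<tau>))\<^sup>2)"
proof -
  let ?v = "\<lambda>j. max 0 (\<bar>G j\<bar> - \<tau>)"
  have "(\<Sum>j<n. G j * h j) \<le> (\<Sum>j<n. \<tau> * \<bar>h j\<bar> + \<bar>?v j\<bar> * \<bar>h j\<bar>)"
  proof (rule sum_mono)
    fix j
    have "G j * h j \<le> \<bar>G j\<bar> * \<bar>h j\<bar>"
      by (simp flip: abs_mult)
    also have "\<dots> \<le> (\<tau> + ?v j) * \<bar>h j\<bar>"
      by (intro mult_right_mono) auto
    finally show "G j * h j \<le> \<tau> * \<bar>h j\<bar> + \<bar>?v j\<bar> * \<bar>h j\<bar>"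
      by (simp add: algebra_simps)
  qed
  also have "\<dots> = \<tau> * l1norm n h + (\<Sum>j<n. \<bar>?v j\<bar> * \<bar>h j\<bar>)"
    by (simp add: sum.distrib l1norm_def sum_distrib_left)
  also have "\<dots> \<le> \<tau> * s + sqrt (\<Sum>j<n. (?v j)\<^sup>2) * l2norm n h"
    using assms by (intro add_mono mult_left_mono cauchy_schwarz_l2norm) auto
  also have "\<dots> \<le> \<tau> * s + sqrt (\<Sum>j<n. (?v j)\<^sup>2) * 1"
    using assms by (intro add_mono mult_left_mono) (auto intro: real_sqrt_ge_zero sum_nonneg)
  finally show ?thesis
    by (simp add: mult.commute)
qed

text \<open>The column sums are independent normal variables of variance \<open>m\<close>, so the
  moment factors into \<open>n\<close> one-dimensional ones, and \<open>1 + x \<le> exp x\<close>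
  gathers the product.\<close>

lemma exp_sum_excess_le:
  assumes m: "0 < m" and n: "0 < n" and \<theta>: "0 \<le> \<theta>"
  shows "(\<integral>\<^sup>+X. ennreal (exp ((\<Sum>j<n. (max 0 (\<bar>\<Sum>i<m. X (i, j)\<bar> - sqrt m * \<theta>))\<^sup>2) / (4 * real m))) \<partial>gaussian_matrix m n)
    \<le> ennreal (exp (2 * sqrt 2 * real n * exp (- \<theta>\<^sup>2 / 2)))"
proof -
  let ?M = "gaussian_matrix m n" and ?K = "{..<m} \<times> {..<n}"
  interpret prob_space ?M
    unfolding gaussian_matrix_def by (intro prob_space_PiM prob_space_std_normal)
  define f where "f j z = ennreal (exp ((max 0 (\<bar>\<Sum>i<m. z (i, j)\<bar> - sqrt m * \<theta>))\<^sup>2 / (4 * real m)))"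
    for j and z :: "nat \<times> nat \<Rightarrow> real"
  have "indep_vars (\<lambda>_. borel) (\<lambda>p X. X p) ?K"
    unfolding gaussian_matrix_def using m n by (intro indep_vars_PiM_std_normal) auto
  \<comment> \<open>Columns are disjoint blocks of independent entries, hence independent of each
    other.\<close>
  then have "indep_vars (\<lambda>j. PiM ({..<m} \<times> {j}) (\<lambda>_. borel)) (\<lambda>j X. restrict (\<lambda>p. X p) ({..<m} \<times> {j})) {..<n}"
    by (rule indep_vars_restrict) (auto simp: disjoint_family_on_def)
  then have "indep_vars (\<lambda>_. borel) (\<lambda>j X. f j (restrict (\<lambda>p. X p) ({..<m} \<times> {j}))) {..<n}"
    by (rule indep_vars_compose2) (unfold f_def, measurable)
  moreover have "f j (restrict (\<lambda>p. X p) ({..<m} \<times> {j})) = f j X" for j X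
    unfolding f_def by simp
  ultimately have indep: "indep_vars (\<lambda>_. borel) f {..<n}"
    by simp
  have f_le: "(\<integral>\<^sup>+X. f j X \<partial>?M) \<le> ennreal (1 + 2 * sqrt 2 * exp (- \<theta>\<^sup>2 / 2))" if j: "j < n" for j
  proof -
    have sum: "(\<Sum>p\<in>{..<m} \<times> {j}. X p * 1) = (\<Sum>i<m. X (i, j))" for X :: "nat \<times> nat \<Rightarrow> real"
      by (rule sum.reindex_bij_witness[of _ "\<lambda>i. (i, j)" fst]) auto
    have "distributed ?M lborel (\<lambda>X. \<Sum>p\<in>{..<m} \<times> {j}. X p * 1) (normal_density 0 (sqrt (\<Sum>p\<in>{..<m} \<times> {j}. 1\<^sup>2)))"
      unfolding gaussian_matrix_def using m j by (intro distributed_PiM_std_normal_linear) auto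
    then have "distributed ?M lborel (\<lambda>X. \<Sum>i<m. X (i, j)) (normal_density 0 (sqrt m))"
      unfolding sum by simp
    from normal_exp_excess_le[OF this _ \<theta>] m show ?thesis
      by (simp add: f_def)
  qed
  have "(\<integral>\<^sup>+X. ennreal (exp ((\<Sum>j<n. (max 0 (\<bar>\<Sum>i<m. X (i, j)\<bar> - sqrt m * \<theta>))\<^sup>2) / (4 * real m))) \<partial>?M)
      = (\<integral>\<^sup>+X. (\<Prod>j<n. f j X) \<partial>?M)"
    unfolding f_def by (simp add: sum_divide_distrib exp_sum prod_ennreal)
  also have "\<dots> = (\<Prod>j<n. \<integral>\<^sup>+X. f j X \<partial>?M)"
    using indep by (intro indep_vars_nn_integral) auto
  also have "\<dots> \<le> (\<Prod>j<n. ennreal (1 + 2 * sqrt 2 * exp (- \<theta>\<^sup>2 / 2)))"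
    using f_le by (intro prod_mono_ennreal) auto
  also have "\<dots> \<le> (\<Prod>j<n. ennreal (exp (2 * sqrt 2 * exp (- \<theta>\<^sup>2 / 2))))"
    by (intro prod_mono_ennreal ennreal_leI exp_ge_add_one_self)
  also have "\<dots> = ennreal (exp (2 * sqrt 2 * real n * exp (- \<theta>\<^sup>2 / 2)))"
    by (simp add: ennreal_power exp_of_nat_mult[symmetric] ac_simps)
  finally show ?thesis .
qed

text \<open>The exponent is \<open>2 * l\<close> times the inner product of \<open>h\<close> with
  the vector of column sums. Thresholding bounds it by a quantity free of \<open>h\<close>, so the
  supremum costs nothing further.\<close>

lemma exp_gaussian_width_le:
  assumes m: "0 < m" and n: "0 < n" and \<theta>: "0 \<le> \<theta>" and l: "0 \<le> l"
    and H: "\<And>h. h \<in> H \<Longrightarrow> l1norm n h \<le> s \<and> l2norm n h \<le> 1"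
  shows "(\<integral>\<^sup>+X. (SUP h\<in>H. ennreal (exp (\<Sum>i<m. 2 * l * matvec n X h i))) \<partial>gaussian_matrix m n)
    \<le> ennreal (exp (2 * l * s * sqrt m * \<theta> + 4 * m * l\<^sup>2 + 2 * sqrt 2 * n * exp (- \<theta>\<^sup>2 / 2)))"
proof -
  let ?M = "gaussian_matrix m n" and ?\<tau> = "sqrt m * \<theta>"
  let ?V2 = "\<lambda>X. \<Sum>j<n. (max 0 (\<bar>\<Sum>i<m. X (i, j)\<bar> - ?\<tau>))\<^sup>2"
  let ?c = "2 * l * s * sqrt m * \<theta> + 4 * m * l\<^sup>2"
  have pointwise: "(SUP h\<in>H. ennreal (exp (\<Sum>i<m. 2 * l * matvec n X h i))) \<le> ennreal (exp ?c) * ennreal (exp (?V2 X / (4 * real m)))" for X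
  proof (rule SUP_least)
    fix h assume h: "h \<in> H"
    let ?V = "sqrt (?V2 X)"
    have V2: "?V\<^sup>2 = ?V2 X"
      by (simp add: sum_nonneg)
    have "(\<Sum>i<m. 2 * l * matvec n X h i) = 2 * l * (\<Sum>j<n. (\<Sum>i<m. X (i, j)) * h j)"
      unfolding matvec_def sum_distrib_left[symmetric] sum_distrib_right by (subst sum.swap) simp
    also have "\<dots> \<le> 2 * l * (s * ?\<tau> + ?V)"
      using H[OF h] l \<theta> by (intro mult_left_mono inner_le_threshold) auto
    \<comment> \<open>Completing the square trades the linear term in \<open>?V\<close> for the
      quadratic one whose exponential moment is known; the weight \<open>1 / (4 * real m)\<close> is
      the one occurring there.\<close>
    also have "2 * l * ?V \<le> 4 * m * l\<^sup>2 + ?V\<^sup>2 / (4 * real m)"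
    proof -
      have "0 \<le> (4 * m * l - ?V)\<^sup>2 / (4 * real m)"
        by simp
      also have "\<dots> = 4 * m * l\<^sup>2 + ?V\<^sup>2 / (4 * real m) - 2 * l * ?V"
        using m by (simp add: power2_diff field_simps power2_eq_square)
      finally show ?thesis by simp
    qed
    then have "2 * l * (s * ?\<tau> + ?V) \<le> ?c + ?V2 X / (4 * real m)"
      unfolding V2 by (simp add: algebra_simps)
    finally show "ennreal (exp (\<Sum>i<m. 2 * l * matvec n X h i)) \<le> ennreal (exp ?c) * ennreal (exp (?V2 X / (4 * real m)))"
      by (simp add: exp_add[symmetric] flip: ennreal_mult)
  qed
  have "(\<lambda>X. X (i, j)) \<in> borel_measurable ?M" if "i < m" "j < n" for i j
    using that measurable_component_singleton[of "(i, j)" "{..<m} \<times> {..<n}" "\<lambda>_. std_normal"]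
    by (auto simp: gaussian_matrix_def cong: measurable_cong_sets)
  then have [measurable]: "?V2 \<in> borel_measurable ?M"
    by measurable
  have "(\<integral>\<^sup>+X. (SUP h\<in>H. ennreal (exp (\<Sum>i<m. 2 * l * matvec n X h i))) \<partial>?M)
      \<le> (\<integral>\<^sup>+X. ennreal (exp ?c) * ennreal (exp (?V2 X / (4 * real m))) \<partial>?M)"
    by (intro nn_integral_mono pointwise)
  also have "\<dots> = ennreal (exp ?c) * (\<integral>\<^sup>+X. ennreal (exp (?V2 X / (4 * real m))) \<partial>?M)"
    by (intro nn_integral_cmult) measurable
  also have "\<dots> \<le> ennreal (exp ?c) * ennreal (exp (2 * sqrt 2 * real n * exp (- \<theta>\<^sup>2 / 2)))"
    by (intro mult_left_mono exp_sum_excess_le m n \<theta>) simp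
  finally show ?thesis
    by (simp add: exp_add[symmetric] flip: ennreal_mult)
qed

text \<open>Chernoff's method for the worst lower deviation: Markov's inequality for the exponential
  supremum \<open>U\<close>, whose mean is controlled by contraction and the width bound. The tilt
  \<open>l\<close>, the threshold \<theta> and the margin \<delta> stay free, to be fixed
  later.\<close>

lemma gaussian_matrix_uniform_lower_bound:
  fixes s \<delta> \<theta> l :: real
  defines "t \<equiv> sqrt (2 * ln 2)"
  assumes m: "0 < m" and n: "0 < n" and s: "1 \<le> s" and \<theta>: "0 \<le> \<theta>" and l: "0 \<le> l"
  shows "\<exists>A \<in> sets (gaussian_matrix m n).
    measure (gaussian_matrix m n) A
      \<ge> 1 - exp (- l * \<delta> + (2 * l * s * sqrt m * \<theta> + 4 * real m * l\<^sup>2 + 2 * sqrt 2 * n * exp (- \<theta>\<^sup>2 / 2))) \<and>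
    (\<forall>X\<in>A. \<forall>h. l2norm n h = 1 \<longrightarrow> l1norm n h \<le> s \<longrightarrow>
      m * (2 * t * eta0) - \<delta> \<le> (\<Sum>i<m. folded_abs t (matvec n X h i)))"
proof -
  let ?M = "gaussian_matrix m n" and ?E = "2 * t * eta0"
  let ?w = "2 * l * s * sqrt m * \<theta> + 4 * real m * l\<^sup>2 + 2 * sqrt 2 * n * exp (- \<theta>\<^sup>2 / 2)"
  interpret prob_space ?M
    unfolding gaussian_matrix_def by (intro prob_space_PiM prob_space_std_normal)
  have t: "0 \<le> t" by (simp add: t_def)
  define T where "T = {h. l2norm n h = 1 \<and> l1norm n h \<le> s}"
  define F where "F X h = (\<Sum>i<m. folded_abs t (matvec n X h i))" for X h
  \<comment> \<open>Countability makes the supremum measurable. Density is in the product topology,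
    where each \<open>F X\<close> is continuous, so the bound on \<open>H\<close> extends to
    \<open>T\<close> at the end.\<close>
  obtain H where H: "countable H" "H \<subseteq> T" "T \<subseteq> closure H"
    using separable[of T] .
  have "(\<lambda>j. if j = 0 then 1 else 0) \<in> T"
    using n s by (simp add: T_def l2norm_def l1norm_def if_distrib[of "\<lambda>x. x\<^sup>2"] if_distrib[of abs] cong: if_cong)
  then have H_ne: "H \<noteq> {}"
    using H by auto
  have mean: "has_bochner_integral (PiM ({i} \<times> {..<n}) (\<lambda>_. std_normal)) (\<lambda>X. folded_abs t (matvec n X h i)) ?E"
    if "h \<in> H" for h i
  proof -
    have "l2norm n h = 1" using that H by (auto simp: T_def)
    then have D: "distributed (PiM ({i} \<times> {..<n}) (\<lambda>_. std_normal)) lborel (\<lambda>X. matvec n X h i) std_normal_density"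
      by (intro distributed_matvec) auto
    have I: "has_bochner_integral lborel (\<lambda>x. std_normal_density x * folded_abs t x) ?E"
      unfolding t_def by (rule has_bochner_integral_folded_abs)
    show ?thesis
      using distributed_integral[OF D, of "folded_abs t"] distributed_integrable[OF D, of "folded_abs t"] I
      by (simp add: has_bochner_integral_iff)
  qed
  have [measurable]: "(\<lambda>X. F X h) \<in> borel_measurable ?M" for h
  proof -
    have "(\<lambda>X. matvec n X h i) \<in> borel_measurable ?M" if "i < m" for i
      unfolding gaussian_matrix_def using that by (intro measurable_matvec) auto
    then show ?thesis unfolding F_def by measurable
  qed
  define U where "U X = (SUP h\<in>H. ennreal (exp (l * (m * ?E - F X h))))" for X
  have [measurable]: "U \<in> borel_measurable ?M"
    unfolding U_def using H by measurable
  have "(\<integral>\<^sup>+X. U X \<partial>?M) =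
    (\<integral>\<^sup>+X. (SUP h\<in>H. ennreal (exp (0 + (\<Sum>i<m. l * (?E - folded_abs t (matvec n X h i)))))) \<partial>?M)"
    unfolding U_def F_def by (simp add: sum_distrib_left[symmetric] sum_subtractf)
  also have "\<dots> \<le> (\<integral>\<^sup>+X. (SUP h\<in>H. ennreal (exp (0 + (\<Sum>i<m. 2 * l * matvec n X h i)))) \<partial>?M)"
    using H H_ne l t mean
    by (intro gaussian_matrix_contraction folded_abs_lipschitz folded_abs_0) auto
  also have "\<dots> \<le> ennreal (exp ?w)"
  proof -
    have "l1norm n h \<le> s \<and> l2norm n h \<le> 1" if "h \<in> H" for h
      using that H by (auto simp: T_def)
    from exp_gaussian_width_le[OF m n \<theta> l this] show ?thesis
      by simp
  qed
  finally have U_le: "(\<integral>\<^sup>+X. U X \<partial>?M) \<le> ennreal (exp ?w)" .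
  define A where "A = {X\<in>space ?M. \<forall>h\<in>H. m * ?E - \<delta> \<le> F X h}"
  have A_sets [measurable]: "A \<in> sets ?M"
    unfolding A_def using H(1) by measurable
  have "emeasure ?M (space ?M - A) \<le> emeasure ?M {X\<in>space ?M. 1 \<le> ennreal (exp (- l * \<delta>)) * U X}"
  proof (intro emeasure_mono subsetI)
    fix X assume X: "X \<in> space ?M - A"
    then obtain h where h: "h \<in> H" "F X h < m * ?E - \<delta>"
      by (auto simp: A_def not_le)
    have "l * \<delta> \<le> l * (m * ?E - F X h)"
      using h l by (intro mult_left_mono) auto
    then have "ennreal 1 \<le> ennreal (exp (- l * \<delta>) * exp (l * (m * ?E - F X h)))"
      by (intro ennreal_leI) (simp add: exp_add[symmetric])
    also have "\<dots> = ennreal (exp (- l * \<delta>)) * ennreal (exp (l * (m * ?E - F X h)))"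
      by (simp add: ennreal_mult)
    also have "\<dots> \<le> ennreal (exp (- l * \<delta>)) * U X"
      unfolding U_def using h by (intro mult_left_mono SUP_upper) auto
    finally show "X \<in> {X\<in>space ?M. 1 \<le> ennreal (exp (- l * \<delta>)) * U X}"
      using X by simp
  qed measurable
  also have "\<dots> \<le> ennreal (exp (- l * \<delta>)) * (\<integral>\<^sup>+X. U X * indicator (space ?M) X \<partial>?M)"
    using nn_integral_Markov_inequality[of U "space ?M" ?M "ennreal (exp (- l * \<delta>))"] by simp
  also have "\<dots> = ennreal (exp (- l * \<delta>)) * (\<integral>\<^sup>+X. U X \<partial>?M)"
    by (intro arg_cong2[where f = "(*)"] nn_integral_cong refl) auto
  also have "\<dots> \<le> ennreal (exp (- l * \<delta>)) * ennreal (exp ?w)"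
    using U_le by (intro mult_left_mono) auto
  also have "\<dots> = ennreal (exp (- l * \<delta> + ?w))"
    by (simp only: exp_add) (simp add: ennreal_mult)
  finally have "prob (space ?M - A) \<le> exp (- l * \<delta> + ?w)"
    by (simp add: emeasure_eq_measure)
  then have "prob A \<ge> 1 - exp (- l * \<delta> + ?w)"
    by (simp add: prob_compl)
  moreover have "m * ?E - \<delta> \<le> F X h" if X: "X \<in> A" and h: "h \<in> T" for X h
  proof -
    have "continuous_on UNIV (\<lambda>h. F X h)"
      unfolding F_def matvec_def folded_abs_def
      by (intro continuous_intros continuous_on_product_coordinates)
    then have "closed {h. m * ?E - \<delta> \<le> F X h}"
      by (intro closed_Collect_le continuous_intros)
    then have "closure H \<subseteq> {h. m * ?E - \<delta> \<le> F X h}"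
      using X by (intro closure_minimal) (auto simp: A_def)
    then show ?thesis using h H by auto
  qed
  ultimately show ?thesis
    using A_sets unfolding T_def F_def by blast
qed

section \<open>The l1-regression estimator\<close>

text \<open>Since \<open>w\<close> is feasible, the residual of \<open>v\<close> is no larger than
  that of \<open>w\<close>. With \<open>g\<close> the matrix image of \<open>w - v\<close>, the
  comparison is made entrywise: where \<open>z i = 0\<close>, \<open>\<bar>g i\<bar>\<close> exceeds
  the change of residual by at most \<open>2 * \<bar>d i\<bar>\<close>; elsewhere that change is at
  least \<open>- \<bar>g i\<bar>\<close> and the penalty \<open>2 * \<tau>\<close> covers the
  rest.\<close>

lemma l1_argmin_folded_abs_le:
  assumes argmin: "is_l1_argmin m n X (\<lambda>i. matvec n X w i + d i + z i) lam v"
    and lam: "l1norm n w \<le> lam" and \<tau>: "0 \<le> \<tau>"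
  shows "(\<Sum>i<m. folded_abs \<tau> (matvec n X (\<lambda>j. w j - v j) i)) \<le> 2 * l1norm m d + 2 * \<tau> * l0norm m z"
proof -
  let ?g = "\<lambda>i. matvec n X (\<lambda>j. w j - v j) i"
  have g: "?g i = matvec n X w i - matvec n X v i" for i
    by (simp add: matvec_def right_diff_distrib sum_subtractf)
  have le: "(\<Sum>i<m. \<bar>?g i + d i + z i\<bar>) \<le> (\<Sum>i<m. \<bar>d i + z i\<bar>)"
    using argmin lam unfolding is_l1_argmin_def l1norm_def g by (auto simp: algebra_simps)
  have "(\<Sum>i<m. folded_abs \<tau> (?g i))
      \<le> (\<Sum>i<m. \<bar>?g i + d i + z i\<bar> - \<bar>d i + z i\<bar> + 2 * \<bar>d i\<bar> + 2 * \<tau> * (if z i \<noteq> 0 then 1 else 0))"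
    using \<tau> by (intro sum_mono) (auto simp: folded_abs_def max_def abs_if)
  also have "\<dots> = (\<Sum>i<m. \<bar>?g i + d i + z i\<bar>) - (\<Sum>i<m. \<bar>d i + z i\<bar>) + 2 * l1norm m d
      + 2 * \<tau> * (\<Sum>i<m. if z i \<noteq> 0 then 1 else 0)"
    by (simp add: sum.distrib sum_subtractf sum_distrib_left l1norm_def)
  also have "(\<Sum>i<m. if z i \<noteq> 0 then 1 else 0 :: real) = real (card {i\<in>{..<m}. z i \<noteq> 0})"
    by (simp add: sum.If_cases Int_def)
  also have "{i\<in>{..<m}. z i \<noteq> 0} = {i. i < m \<and> z i \<noteq> 0}"
    by auto
  finally show ?thesis
    using le by (simp add: l0norm_def)
qed

text \<open>The cone condition, relaxed by the slack in \<open>lam\<close>. Off the support of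
  \<open>w\<close> the error is \<open>\<bar>v j\<bar>\<close>; on the support the triangle
  inequality costs twice the error there, and Cauchy-Schwarz over at most \<open>k\<close> entries
  turns this into the l2-norm.\<close>

lemma l1norm_diff_le_of_sparse:
  assumes sparse: "l0norm n w \<le> k" and v: "l1norm n v \<le> lam"
  shows "l1norm n (\<lambda>j. w j - v j) \<le> 2 * sqrt k * l2norm n (\<lambda>j. w j - v j) + (lam - l1norm n w)"
proof -
  let ?h = "\<lambda>j. w j - v j"
  define S where "S = {j. j < n \<and> w j \<noteq> 0}"
  have S: "S \<subseteq> {..<n}" "finite S" "card S \<le> k"
    using sparse by (auto simp: S_def l0norm_def)
  have "l1norm n ?h \<le> (\<Sum>j<n. \<bar>v j\<bar> - \<bar>w j\<bar> + 2 * (if w j \<noteq> 0 then \<bar>?h j\<bar> else 0))"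
    unfolding l1norm_def by (intro sum_mono) auto
  also have "\<dots> = l1norm n v - l1norm n w + 2 * (\<Sum>j<n. if w j \<noteq> 0 then \<bar>?h j\<bar> else 0)"
    by (simp add: sum.distrib sum_subtractf sum_distrib_left l1norm_def)
  also have "(\<Sum>j<n. if w j \<noteq> 0 then \<bar>?h j\<bar> else 0) = (\<Sum>j\<in>S. \<bar>1\<bar> * \<bar>?h j\<bar>)"
    by (simp add: S_def sum.If_cases Int_def)
  also have "\<dots> \<le> sqrt (\<Sum>j\<in>S. 1\<^sup>2) * l2norm n ?h"
    by (rule cauchy_schwarz_l2norm[OF S(1)])
  also have "\<dots> \<le> sqrt k * l2norm n ?h"
    using S(3) by (intro mult_right_mono) (auto simp: l2norm_def sum_nonneg)
  finally show ?thesis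
    using v by simp
qed

lemma l2norm_scale: "l2norm n (\<lambda>j. c * h j) = \<bar>c\<bar> * l2norm n h"
  by (simp add: l2norm_def power_mult_distrib sum_distrib_left[symmetric] real_sqrt_mult)

lemma l1norm_scale: "l1norm n (\<lambda>j. c * h j) = \<bar>c\<bar> * l1norm n h"
  by (simp add: l1norm_def abs_mult sum_distrib_left)

lemma matvec_scale: "matvec n X (\<lambda>j. c * h j) i = c * matvec n X h i"
  by (simp add: matvec_def sum_distrib_left ac_simps)

lemma l1norm_nonneg: "0 \<le> l1norm n h"
  by (simp add: l1norm_def sum_nonneg)

section \<open>Numerical choice of the parameters\<close>

lemma ln_exp_ratio_ge_1:
  fixes a n :: real
  assumes "0 < a" "a \<le> n"
  shows "1 \<le> ln (exp 1 * n / a)"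
proof -
  have "ln (exp 1) \<le> ln (exp 1 * n / a)"
    using assms by (subst ln_le_cancel_iff) (auto simp: field_simps)
  then show ?thesis by simp
qed

text \<open>The uniform bound is evaluated at tilt \<open>\<epsilon> / 16\<close>, margin
  \<open>t * \<epsilon> * m\<close>, radius \<open>3 * \<alpha> * sqrt k\<close> and threshold
  \<open>sqrt (2 * L)\<close>. In units of \<open>\<epsilon>\<^sup>2 * m / 64\<close> the margin
  gains 4 and each of the three error terms loses at most 1.\<close>

lemma gaussian_failure_exponent_le:
  fixes \<epsilon> \<alpha> k m n t :: real
  defines "L \<equiv> ln (exp 1 * n / (\<alpha>\<^sup>2 * \<epsilon> * k))"
  assumes \<epsilon>: "0 < \<epsilon>" "\<epsilon> \<le> 2" and \<alpha>: "0 < \<alpha>" and k: "0 < k" and n: "\<alpha>\<^sup>2 * \<epsilon> * k \<le> n"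
    and m: "1152 * \<alpha>\<^sup>2 / \<epsilon>\<^sup>2 * k * L < m" and t: "1 \<le> t"
  shows "- (\<epsilon> / 16) * (t * \<epsilon> * m) + (2 * (\<epsilon> / 16) * (3 * \<alpha> * sqrt k) * sqrt m * sqrt (2 * L)
      + 4 * m * (\<epsilon> / 16)\<^sup>2 + 2 * sqrt 2 * n * exp (- (sqrt (2 * L))\<^sup>2 / 2)) \<le> - (1 / 64) * \<epsilon>\<^sup>2 * m"
proof -
  have pos: "0 < \<alpha>\<^sup>2 * \<epsilon> * k" using \<epsilon> \<alpha> k by simp
  then have n0: "0 < n" using n by linarith
  have L: "1 \<le> L"
    unfolding L_def using pos n by (rule ln_exp_ratio_ge_1)
  have kL: "1152 * (\<alpha>\<^sup>2 * k * L) \<le> \<epsilon>\<^sup>2 * m"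
    using m \<epsilon> by (simp add: field_simps)
  have "\<alpha>\<^sup>2 * k * 1 \<le> \<alpha>\<^sup>2 * k * L"
    using L k by (intro mult_left_mono) auto
  then have k1: "1152 * (\<alpha>\<^sup>2 * k) \<le> \<epsilon>\<^sup>2 * m"
    using kL by simp
  have m0: "0 \<le> m"
  proof -
    have "0 \<le> \<epsilon>\<^sup>2 * m" using k1 k by (smt (verit) mult_nonneg_nonneg zero_le_power2)
    then show ?thesis using \<epsilon> by (simp add: zero_le_mult_iff)
  qed
  have dev: "- (\<epsilon> / 16) * (t * \<epsilon> * m) \<le> - (1 / 16) * (\<epsilon>\<^sup>2 * m)"
    using mult_right_mono[OF t, of "\<epsilon>\<^sup>2 * m"] mult_nonneg_nonneg[OF zero_le_power2 m0, of \<epsilon>]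
    by (simp add: power2_eq_square algebra_simps)
  have width: "2 * (\<epsilon> / 16) * (3 * \<alpha> * sqrt k) * sqrt m * sqrt (2 * L) \<le> 1 / 64 * (\<epsilon>\<^sup>2 * m)"
  proof -
    \<comment> \<open>This term fixes the constant: \<open>18 * \<alpha>\<^sup>2 * k * L \<le>
      \<epsilon>\<^sup>2 * m / 64\<close> is the assumption on \<open>m\<close>, as
      \<open>1152 = 18 * 64\<close>.\<close>
    have "(3 * \<alpha> * sqrt k) * sqrt m * sqrt (2 * L) = sqrt ((3 * \<alpha>)\<^sup>2 * k * m * (2 * L))"
      using \<alpha> by (simp only: real_sqrt_mult real_sqrt_abs)
    also have "\<dots> \<le> sqrt ((\<epsilon> * m / 8)\<^sup>2)"
    proof (rule real_sqrt_le_mono)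
      have "18 * (\<alpha>\<^sup>2 * k * L) * m \<le> (1 / 64 * (\<epsilon>\<^sup>2 * m)) * m"
        using kL m0 by (intro mult_right_mono) auto
      then show "(3 * \<alpha>)\<^sup>2 * k * m * (2 * L) \<le> (\<epsilon> * m / 8)\<^sup>2"
        by (simp add: power2_eq_square algebra_simps)
    qed
    also have "\<dots> = \<epsilon> * m / 8"
      using \<epsilon> m0 by simp
    finally have "2 * (\<epsilon> / 16) * ((3 * \<alpha> * sqrt k) * sqrt m * sqrt (2 * L)) \<le> 2 * (\<epsilon> / 16) * (\<epsilon> * m / 8)"
      using \<epsilon> by (intro mult_left_mono) auto
    then show ?thesis
      by (simp add: power2_eq_square algebra_simps)
  qed
  have excess: "2 * sqrt 2 * n * exp (- (sqrt (2 * L))\<^sup>2 / 2) \<le> 1 / 64 * (\<epsilon>\<^sup>2 * m)"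
  proof -
    \<comment> \<open>The threshold is chosen so that \<open>exp (- L)\<close> cancels
      \<open>n\<close>, leaving a multiple of
      \<open>\<alpha>\<^sup>2 * \<epsilon> * k\<close>.\<close>
    have "n * exp (- (sqrt (2 * L))\<^sup>2 / 2) = n * exp (- L)"
      using L by simp
    also have "\<dots> = \<alpha>\<^sup>2 * \<epsilon> * k / exp 1"
      unfolding L_def using pos n0 by (simp add: exp_minus field_simps)
    also have "\<dots> \<le> \<alpha>\<^sup>2 * \<epsilon> * k / 1"
      using pos by (intro divide_left_mono) auto
    also have "\<dots> \<le> \<alpha>\<^sup>2 * 2 * k"
      using \<epsilon> k by (simp add: mult_left_mono mult_right_mono)
    finally have "n * exp (- (sqrt (2 * L))\<^sup>2 / 2) \<le> \<alpha>\<^sup>2 * 2 * k" .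
    then have "2 * sqrt 2 * (n * exp (- (sqrt (2 * L))\<^sup>2 / 2)) \<le> (2 * 2) * (\<alpha>\<^sup>2 * 2 * k)"
      by (rule mult_mono[rotated]) (use n0 sqrt2_less_2 in auto)
    moreover have "0 \<le> \<alpha>\<^sup>2 * k"
      using k by simp
    ultimately show ?thesis
      using k1 unfolding mult.assoc by linarith
  qed
  have "4 * m * (\<epsilon> / 16)\<^sup>2 = 1 / 64 * (\<epsilon>\<^sup>2 * m)"
    by (simp add: power2_eq_square)
  then show ?thesis
    using dev width excess by linarith
qed

text \<open>Equivalent to \<open>exp 1 \<le> 4\<close>; it allows the factor \<open>t\<close> to be
  dropped from the deviation and from the final error bound.\<close>

lemma sqrt_2_ln_2_ge_1: "1 \<le> sqrt (2 * ln 2)"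
proof -
  have "ln (exp 1) \<le> ln (2\<^sup>2 :: real)"
    using exp_le by (subst ln_le_cancel_iff) auto
  also have "\<dots> = 2 * ln 2"
    by (subst ln_realpow) auto
  finally show ?thesis by simp
qed

text \<open>If \<open>r \<le> D\<close>, the \<lambda>-term alone suffices. Otherwise the slack in
  \<open>lam\<close> is at most \<open>\<alpha> * sqrt k * r\<close>, which puts the normalized
  error among the unit vectors controlled by \<open>X\<close>; the lower bound there meets the upper
  bound from optimality.\<close>

lemma l1_regression_error_le:
  fixes \<epsilon> \<eta> \<alpha> :: real
  defines "t \<equiv> sqrt (2 * ln 2)"
  assumes \<epsilon>: "0 < \<epsilon>" "\<epsilon> \<le> 2" and \<eta>: "\<eta> < eta0 - \<epsilon>" and \<alpha>: "2 / \<epsilon> \<le> \<alpha>" and k: "1 \<le> k" and m: "0 < m"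
    and X: "\<And>h. l2norm n h = 1 \<Longrightarrow> l1norm n h \<le> 3 * \<alpha> * sqrt k \<Longrightarrow>
      m * (2 * t * eta0) - t * \<epsilon> * m \<le> (\<Sum>i<m. folded_abs t (matvec n X h i))"
    and sparse: "l0norm n w \<le> k" "real (l0norm m z) \<le> \<eta> * m" and lam: "l1norm n w \<le> lam"
    and argmin: "is_l1_argmin m n X (\<lambda>i. matvec n X w i + d i + z i) lam v"
  shows "l2norm n (\<lambda>j. w j - v j)
    \<le> 2 * (1 / (\<epsilon> - 1 / \<alpha>) * (l1norm m d / m) + (lam - l1norm n w) / (\<alpha> * sqrt k))"
proof -
  let ?h = "\<lambda>j. w j - v j"
  define r where "r = l2norm n ?h"
  have t: "1 \<le> t" unfolding t_def by (rule sqrt_2_ln_2_ge_1)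
  have \<alpha>1: "1 \<le> \<alpha>" "0 < \<alpha>"
    using \<epsilon> \<alpha> by (auto intro: order_trans[of 1 "2 / \<epsilon>"] less_le_trans[of 0 "2 / \<epsilon>"])
  have gap: "0 < \<epsilon> - 1 / \<alpha>" "\<epsilon> - 1 / \<alpha> \<le> \<epsilon>"
    using \<epsilon> \<alpha> \<alpha>1 by (auto simp: field_simps)
  have sk: "0 < sqrt k" using k by simp
  define B D where "B = 1 / (\<epsilon> - 1 / \<alpha>) * (l1norm m d / m)" and "D = (lam - l1norm n w) / (\<alpha> * sqrt k)"
  have nonneg: "0 \<le> B" "0 \<le> D"
    unfolding B_def D_def using gap \<alpha>1 sk lam l1norm_nonneg[of m d] by auto
  have "r \<le> 2 * (B + D)"
  proof (cases "r \<le> D")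
    case True
    then show ?thesis using nonneg by simp
  next
    case False
    then have r: "0 < r" using nonneg by linarith
    have "lam - l1norm n w \<le> \<alpha> * sqrt k * r"
      using False \<alpha>1 sk by (simp add: D_def field_simps)
    then have "l1norm n ?h \<le> 2 * sqrt k * r + \<alpha> * sqrt k * r"
      using l1norm_diff_le_of_sparse[OF sparse(1), of v lam] argmin
      by (simp add: r_def is_l1_argmin_def)
    also have "\<dots> = (2 + \<alpha>) * (sqrt k * r)"
      by (simp add: algebra_simps)
    also have "\<dots> \<le> (3 * \<alpha>) * (sqrt k * r)"
      using \<alpha>1 sk r by (intro mult_right_mono) auto
    finally have l1: "l1norm n ?h / r \<le> 3 * \<alpha> * sqrt k"
      using r by (simp add: field_simps)
    define u where "u = (\<lambda>j. inverse r * ?h j)"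
    have "m * (2 * t * eta0) - t * \<epsilon> * m \<le> (\<Sum>i<m. folded_abs t (matvec n X u i))"
    proof (rule X)
      show "l2norm n u = 1"
        using r unfolding u_def l2norm_scale r_def[symmetric] by simp
      show "l1norm n u \<le> 3 * \<alpha> * sqrt k"
        using l1 r unfolding u_def l1norm_scale by (simp add: divide_inverse mult.commute)
    qed
    then have "r * (m * (2 * t * eta0) - t * \<epsilon> * m) \<le> r * (\<Sum>i<m. folded_abs t (matvec n X u i))"
      using r by (intro mult_left_mono) auto
    \<comment> \<open>Undoing the normalization rescales the threshold as well, so a corrupted entry
      now costs \<open>2 * (r * t)\<close>.\<close>
    also have "\<dots> = (\<Sum>i<m. folded_abs (r * t) (matvec n X ?h i))"
      using r unfolding u_def matvec_scale sum_distrib_left by (simp add: folded_abs_scale mult.assoc[symmetric])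
    also have "\<dots> \<le> 2 * l1norm m d + 2 * (r * t) * l0norm m z"
      using r t by (intro l1_argmin_folded_abs_le[OF argmin lam]) auto
    also have "\<dots> \<le> 2 * l1norm m d + 2 * (r * t) * (\<eta> * m)"
      using sparse(2) r t by (intro add_left_mono mult_left_mono) auto
    also have "\<dots> \<le> 2 * l1norm m d + 2 * (r * t) * ((eta0 - \<epsilon>) * m)"
      using r t \<eta> by (intro add_left_mono mult_left_mono mult_right_mono) auto
    \<comment> \<open>The corruption bound leaves a margin of \<open>2 * t * \<epsilon> * m\<close>
      per unit of \<open>r\<close>; the deviation spends half of it.\<close>
    finally have "t * (r * (\<epsilon> * m)) \<le> 2 * l1norm m d"
      by (simp add: algebra_simps)
    moreover have "1 * (r * (\<epsilon> * m)) \<le> t * (r * (\<epsilon> * m))"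
      using t r \<epsilon> by (intro mult_right_mono) auto
    ultimately have "r * (\<epsilon> * m) \<le> 2 * l1norm m d"
      by linarith
    then have "r \<le> 2 * (1 / \<epsilon> * (l1norm m d / m))"
      using \<epsilon> m by (simp add: field_simps)
    also have "\<dots> \<le> 2 * B"
      unfolding B_def using gap mult_pos_pos[OF \<epsilon>(1) gap(1)] l1norm_nonneg[of m d] by (intro mult_left_mono mult_right_mono divide_left_mono) auto
    finally show ?thesis
      using nonneg by simp
  qed
  then show ?thesis
    by (simp only: r_def B_def D_def)
qed

text \<open>The constants are quantified before all parameters, hence absolute. The probability is
  carried by a measurable set \<open>A\<close> of good matrices, because the success event itself
  quantifies over uncountably many vectors. The bound
  \<open>\<alpha>\<^sup>2 * \<epsilon> * real k \<le> real n\<close> keeps the logarithm at least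
  1.\<close>

theorem theorem1p1:
  "\<exists>C c K :: real. C > 0 \<and> c > 0 \<and> K > 0 \<and>
    (\<forall>(\<epsilon>::real) (\<eta>::real) (\<alpha>::real) (k::nat) (m::nat) (n::nat).
       \<epsilon> > 0 \<longrightarrow> \<eta> < eta0 - \<epsilon> \<longrightarrow> \<alpha> \<ge> 2 / \<epsilon> \<longrightarrow>
       k \<ge> 1 \<longrightarrow> \<alpha>\<^sup>2 * \<epsilon> * real k \<le> real n \<longrightarrow>
       real m > C * \<alpha>\<^sup>2 / \<epsilon>\<^sup>2 * real k * ln (exp 1 * real n / (\<alpha>\<^sup>2 * \<epsilon> * real k)) \<longrightarrow>
       (\<exists>A \<in> sets (gaussian_matrix m n).
          measure (gaussian_matrix m n) A \<ge> 1 - exp (- c * \<epsilon>\<^sup>2 * real m) \<and>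
          (\<forall>X \<in> A. \<forall>w_star zeta d lam w_hat.
             l0norm n w_star \<le> k \<longrightarrow>
             real (l0norm m zeta) \<le> \<eta> * real m \<longrightarrow>
             lam \<ge> l1norm n w_star \<longrightarrow>
             is_l1_argmin m n X (\<lambda>i. matvec n X w_star i + d i + zeta i) lam w_hat \<longrightarrow>
             l2norm n (\<lambda>j. w_star j - w_hat j)
               \<le> K * (1 / (\<epsilon> - 1 / \<alpha>) * (l1norm m d / real m)
                      + (lam - l1norm n w_star) / (\<alpha> * sqrt (real k))))))"
proof (rule exI[of _ 1152], rule exI[of _ "1 / 64"], rule exI[of _ 2], intro conjI allI impI)
  fix \<epsilon> \<eta> \<alpha> :: real and k m n :: nat
  assume \<epsilon>: "\<epsilon> > 0" and \<eta>: "\<eta> < eta0 - \<epsilon>" and \<alpha>: "\<alpha> \<ge> 2 / \<epsilon>" and k: "k \<ge> 1"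
    and n: "\<alpha>\<^sup>2 * \<epsilon> * real k \<le> real n"
    and m: "real m > 1152 * \<alpha>\<^sup>2 / \<epsilon>\<^sup>2 * real k * ln (exp 1 * real n / (\<alpha>\<^sup>2 * \<epsilon> * real k))"
  define L where "L = ln (exp 1 * real n / (\<alpha>\<^sup>2 * \<epsilon> * real k))"
  have \<alpha>0: "0 < \<alpha>" using \<epsilon> \<alpha> by (auto intro: less_le_trans[of 0 "2 / \<epsilon>"])
  have pos: "0 < \<alpha>\<^sup>2 * \<epsilon> * real k" using \<epsilon> \<alpha>0 k by simp
  then have n0: "0 < n" using n by (intro gr0I) auto
  have L: "0 \<le> L"
    unfolding L_def using ln_exp_ratio_ge_1[OF pos n] by simp
  have m0: "0 < m"
    using m L k unfolding L_def[symmetric] by (smt (verit) divide_nonneg_nonneg mult_nonneg_nonneg of_nat_0_le_iff of_nat_0_less_iff zero_le_power2)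
  interpret prob_space "gaussian_matrix m n"
    unfolding gaussian_matrix_def by (intro prob_space_PiM prob_space_std_normal)
  let ?concl = "\<lambda>X. \<forall>w_star zeta d lam w_hat.
             l0norm n w_star \<le> k \<longrightarrow>
             real (l0norm m zeta) \<le> \<eta> * real m \<longrightarrow>
             lam \<ge> l1norm n w_star \<longrightarrow>
             is_l1_argmin m n X (\<lambda>i. matvec n X w_star i + d i + zeta i) lam w_hat \<longrightarrow>
             l2norm n (\<lambda>j. w_star j - w_hat j)
               \<le> 2 * (1 / (\<epsilon> - 1 / \<alpha>) * (l1norm m d / real m)
                      + (lam - l1norm n w_star) / (\<alpha> * sqrt (real k)))"
  show "\<exists>A \<in> events. prob A \<ge> 1 - exp (- (1 / 64) * \<epsilon>\<^sup>2 * real m) \<and> (\<forall>X\<in>A. ?concl X)"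
  proof (cases "\<eta> < 0")
    \<comment> \<open>No \<open>zeta\<close> has negative support size, so the conclusion is vacuous
      and the whole space serves as \<open>A\<close>.\<close>
    case True
    then have "\<eta> * real m < 0" using m0 by (simp add: mult_neg_pos)
    then have "?concl X" for X
      by (auto simp: not_le intro: less_le_trans)
    then show ?thesis
      by (intro bexI[of _ "space (gaussian_matrix m n)"]) (auto simp: prob_space)
  next
    case False
    \<comment> \<open>A crude bound on \<open>eta0\<close> is enough: with \<eta> nonnegative it
      gives \<open>\<epsilon> \<le> 2\<close>, hence \<open>1 \<le> \<alpha>\<close>.\<close>
    have "0 \<le> Phi (sqrt (2 * ln 2))" by (simp add: Phi_def)
    then have "eta0 \<le> 2" by (simp add: eta0_def)
    then have \<epsilon>2: "\<epsilon> \<le> 2" using \<eta> False by linarith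
    let ?t = "sqrt (2 * ln 2)" and ?s = "3 * \<alpha> * sqrt (real k)"
    have "1 \<le> \<alpha>" using \<epsilon> \<epsilon>2 \<alpha> by (auto intro: order_trans[of 1 "2 / \<epsilon>"])
    then have "1 * 1 \<le> (3 * \<alpha>) * sqrt (real k)" using k by (intro mult_mono) auto
    then have s: "1 \<le> ?s" by simp
    obtain A where A: "A \<in> events"
        "prob A \<ge> 1 - exp (- (\<epsilon> / 16) * (?t * \<epsilon> * m) + (2 * (\<epsilon> / 16) * ?s * sqrt m * sqrt (2 * L)
          + 4 * m * (\<epsilon> / 16)\<^sup>2 + 2 * sqrt 2 * n * exp (- (sqrt (2 * L))\<^sup>2 / 2)))"
      and AX: "\<And>X h. X \<in> A \<Longrightarrow> l2norm n h = 1 \<Longrightarrow> l1norm n h \<le> ?s \<Longrightarrow>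
          m * (2 * ?t * eta0) - ?t * \<epsilon> * m \<le> (\<Sum>i<m. folded_abs ?t (matvec n X h i))"
      using gaussian_matrix_uniform_lower_bound[OF m0 n0 s, of "sqrt (2 * L)" "\<epsilon> / 16" "?t * \<epsilon> * m"] L \<epsilon>
      by auto
    have concl: "?concl X" if "X \<in> A" for X
      using l1_regression_error_le[OF \<epsilon> \<epsilon>2 \<eta> \<alpha> k m0 AX[OF that]] by blast
    have "exp (- (\<epsilon> / 16) * (?t * \<epsilon> * m) + (2 * (\<epsilon> / 16) * ?s * sqrt m * sqrt (2 * L)
          + 4 * m * (\<epsilon> / 16)\<^sup>2 + 2 * sqrt 2 * n * exp (- (sqrt (2 * L))\<^sup>2 / 2))) \<le> exp (- (1 / 64) * \<epsilon>\<^sup>2 * m)"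
      using gaussian_failure_exponent_le[OF \<epsilon> \<epsilon>2 \<alpha>0 _ n m sqrt_2_ln_2_ge_1] k
      unfolding L_def by (simp only: exp_le_cancel_iff) simp
    then have "prob A \<ge> 1 - exp (- (1 / 64) * \<epsilon>\<^sup>2 * m)"
      using A(2) by linarith
    then show ?thesis
      using A(1) concl by blast
  qed
qed simp_all

end
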